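(* Let $X\in\mathbb{R}^{m\times n}_{\le r}\cap\mathcal{H}$ with $\operatorname{rank}(X)=s$ and singular value decomposition $X=U\Sigma V^\top=HV^\top$, where $U\in\mathrm{St}(m,s)$, $\Sigma\in\mathbb{R}^{s\times s}$, $V\in\mathrm{St}(n,s)$ and $H=U\Sigma$. Then the Bouligand tangent cone is $$\mathrm{T}_X\big(\mathbb{R}^{m\times n}_{\le r}\cap\mathcal{H}\big)=\Big\{KV^\top+UJV_\bot^\top+U_\bot RV_\bot^\top:\ K\in\mathrm{T}_H\mathcal{H}^s,\ J\in\mathbb{R}^{s\times(n-s)},\ R\in\mathbb{R}^{(m-s)\times(n-s)},\ \operatorname{rank}(R)\le r-s\Big\}.$$ Moreover, $\mathbb{R}^{m\times n}_{\le r}\cap\mathcal{H}$ is geometrically derivable at each of its points.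
   Context: Let $r\le\min\{m,n\}$ and $\mathbb{R}^{m\times n}_{\le r}=\{X\in\mathbb{R}^{m\times n}:\operatorname{rank}(X)\le r\}$. The map $h:\mathbb{R}^{m\times n}\to\mathbb{R}^q$ is smooth and orthogonally invariant, i.e. $h(XQ)=h(X)$ for all $X$ and all $Q\in\mathcal{O}(n)=\{Q\in\mathbb{R}^{n\times n}:Q^\top Q=I_n\}$. Put $\mathcal{H}=\{X\in\mathbb{R}^{m\times n}:h(X)=0\}$; it is assumed that the differential $\mathrm{D}h_X$ has rank $q$ for all $X\in\mathcal{H}$ (so $\mathcal{H}$ is an embedded submanifold). For $s\le n$ define $h^s:\mathbb{R}^{m\times s}\to\mathbb{R}^q$, $h^s(H)=h([H\ \ 0^{m\times(n-s)}])$, and $\mathcal{H}^s=\{H\in\mathbb{R}^{m\times s}:h^s(H)=0\}$; when nonempty, $\mathcal{H}^s$ is an embedded submanifold of $\mathbb{R}^{m\times s}$, with tangent space $\mathrm{T}_H\mathcal{H}^s$ at $H$. If $X=HV^\top\in\mathcal{H}$ with $V\in\mathrm{St}(n,s)$, then $H\in\mathcal{H}^s$. (If $s=0$, matrices with zero columns are empty and the corresponding terms vanish.) $\mathrm{St}(n,s)=\{V\in\mathbb{R}^{n\times s}:V^\top V=I_s\}$, and for $V\in\mathrm{St}(n,s)$, $V_\bot$ denotes a matrix with $[V\ V_\bot]\in\mathcal{O}(n)$ (similarly $U_\bot$). The Bouligand tangent cone to a set $\mathcal{X}$ at $X\in\mathcal{X}$ is $\mathrm{T}_X\mathcal{X}=\{\eta=\lim_{k\to\infty}(X_k-X)/t_k:\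 X_k\in\mathcal{X},\ t_k>0\text{ for all }k,\ t_k\to0\}$. A vector $\eta\in\mathrm{T}_X\mathcal{X}$ is derivable if there is a curve $\gamma(t)$ on $\mathcal{X}$ with $\gamma(0)=X$ and $\gamma'(0)=\eta$; $\mathcal{X}$ is geometrically derivable at $X$ if every vector in $\mathrm{T}_X\mathcal{X}$ is derivable. *)

theory Defs
  imports
    "HOL-Analysis.Analysis"
    "Jordan_Normal_Form.DL_Rank"
begin

text \<open>
  The ambient space of m by n matrices is \<^typ>\<open>real^'n^'m\<close>.  The factors of a singular value
  decomposition have dimensions that depend on the rank s and may be 0 (s, n - s or m - s), so they
  are matrices of type \<^typ>\<open>real mat\<close> with explicit carriers.  The function below reads such a
  matrix, of dimensions CARD('m) and CARD('n), as an element of \<^typ>\<open>real^'n^'m\<close>; it is a bijection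
  from that carrier, given by one fixed enumeration of each index type.
\<close>

definition cart_of_mat :: "real mat \<Rightarrow> real^'n::finite^'m::finite" where
  "cart_of_mat A =
     (\<chi> i j. A $$ (to_nat_on (UNIV::'m set) i, to_nat_on (UNIV::'n set) j))"

definition hcat :: "real mat \<Rightarrow> real mat \<Rightarrow> real mat" where
  "hcat A B = four_block_mat A B (0\<^sub>m 0 (dim_col A)) (0\<^sub>m 0 (dim_col B))"

definition stiefel :: "nat \<Rightarrow> nat \<Rightarrow> real mat set" where
  "stiefel n s = {V \<in> carrier_mat n s. V\<^sup>T * V = 1\<^sub>m s}"

definition orth_completion :: "nat \<Rightarrow> nat \<Rightarrow> real mat \<Rightarrow> real mat \<Rightarrow> bool" where
  "orth_completion n s V V_perp \<longleftrightarrow>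
     V_perp \<in> carrier_mat n (n - s) \<and> hcat V V_perp \<in> stiefel n n"

text \<open>
  A singular value decomposition restricted to the s nonzero singular values; no order is imposed
  on them.
\<close>

definition thin_svd :: "nat \<Rightarrow> real^'n::finite^'m::finite \<Rightarrow> real mat \<Rightarrow> real mat \<Rightarrow> real mat \<Rightarrow> bool" where
  "thin_svd s X U \<Sigma> V \<longleftrightarrow>
     U \<in> stiefel CARD('m) s \<and> V \<in> stiefel CARD('n) s \<and>
     \<Sigma> \<in> carrier_mat s s \<and> diagonal_mat \<Sigma> \<and> (\<forall>i<s. 0 < \<Sigma> $$ (i, i)) \<and>
     X = cart_of_mat (U * \<Sigma> * V\<^sup>T)"

text \<open>
  On an open subset of a finite-dimensional space, \<^term>\<open>C_k_on S f k\<close> says that f is k times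
  continuously differentiable: the derivative is C^(k-1) iff all directional derivatives are.
\<close>

primrec C_k_on :: "'a::real_normed_vector set \<Rightarrow> ('a \<Rightarrow> 'b::real_normed_vector) \<Rightarrow> nat \<Rightarrow> bool" where
  "C_k_on S f 0 \<longleftrightarrow> continuous_on S f"
| "C_k_on S f (Suc k) \<longleftrightarrow>
     (\<forall>x\<in>S. f differentiable (at x)) \<and>
     (\<forall>v. C_k_on S (\<lambda>x. frechet_derivative f (at x) v) k)"

definition smooth_on :: "'a::real_normed_vector set \<Rightarrow> ('a \<Rightarrow> 'b::real_normed_vector) \<Rightarrow> bool" where
  "smooth_on S f \<longleftrightarrow> (\<forall>k. C_k_on S f k)"

definition orthogonally_invariant :: "(real^'n::finite^'m::finite \<Rightarrow> 'b) \<Rightarrow> bool" where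
  "orthogonally_invariant h \<longleftrightarrow> (\<forall>X Q. orthogonal_matrix Q \<longrightarrow> h (X ** Q) = h X)"

definition rank_le :: "nat \<Rightarrow> (real^'n::finite^'m::finite) set" where
  "rank_le r = {X. rank X \<le> r}"

definition zero_set :: "('a \<Rightarrow> 'b::zero) \<Rightarrow> 'a set" where
  "zero_set h = {X. h X = 0}"

text \<open>
  \<open>h_restr h s\<close> is the map H |-> h([H 0]) on m by s matrices and \<open>zero_set_restr h s\<close> its zero set.
\<close>

definition h_restr :: "(real^'n::finite^'m::finite \<Rightarrow> 'b) \<Rightarrow> nat \<Rightarrow> real mat \<Rightarrow> 'b" where
  "h_restr h s H = h (cart_of_mat (hcat H (0\<^sub>m CARD('m) (CARD('n) - s))))"

definition zero_set_restr :: "(real^'n::finite^'m::finite \<Rightarrow> 'b::zero) \<Rightarrow> nat \<Rightarrow> real mat set" where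
  "zero_set_restr h s = {H \<in> carrier_mat CARD('m) s. h_restr h s H = 0}"

text \<open>
  The tangent space of an embedded submanifold of a space of matrices: the velocities at H of the
  smooth curves on M through H (smoothness and derivatives taken entrywise).
\<close>

definition tangent_space :: "real mat set \<Rightarrow> real mat \<Rightarrow> real mat set" where
  "tangent_space M H =
     {K \<in> carrier_mat (dim_row H) (dim_col H).
        \<exists>\<epsilon>>0. \<exists>\<gamma>. (\<forall>t\<in>{-\<epsilon><..<\<epsilon>}. \<gamma> t \<in> M \<and> \<gamma> t \<in> carrier_mat (dim_row H) (dim_col H)) \<and> \<gamma> 0 = H \<and>
          (\<forall>i<dim_row H. \<forall>j<dim_col H.
             smooth_on {-\<epsilon><..<\<epsilon>} (\<lambda>t. \<gamma> t $$ (i, j)) \<and>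
             ((\<lambda>t. \<gamma> t $$ (i, j)) has_real_derivative K $$ (i, j)) (at 0))}"

definition bouligand_cone :: "'a::real_normed_vector set \<Rightarrow> 'a \<Rightarrow> 'a set" where
  "bouligand_cone S x =
     {\<eta>. \<exists>(X :: nat \<Rightarrow> 'a) (t :: nat \<Rightarrow> real).
        (\<forall>k. X k \<in> S \<and> t k > 0) \<and> t \<longlonglongrightarrow> 0 \<and> (\<lambda>k. (X k - x) /\<^sub>R t k) \<longlonglongrightarrow> \<eta>}"

definition derivable :: "'a::real_normed_vector set \<Rightarrow> 'a \<Rightarrow> 'a \<Rightarrow> bool" where
  "derivable S x \<eta> \<longleftrightarrow>
     (\<exists>\<epsilon>>0. \<exists>\<gamma> :: real \<Rightarrow> 'a.
        continuous_on {-\<epsilon><..<\<epsilon>} \<gamma> \<and> (\<forall>t\<in>{-\<epsilon><..<\<epsilon>}. \<gamma> t \<in> S) \<and>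
        \<gamma> 0 = x \<and> (\<gamma> has_vector_derivative \<eta>) (at 0))"

definition geometrically_derivable_at :: "'a::real_normed_vector set \<Rightarrow> 'a \<Rightarrow> bool" where
  "geometrically_derivable_at S x \<longleftrightarrow> (\<forall>\<eta>\<in>bouligand_cone S x. derivable S x \<eta>)"

end

theory Submission
  imports Defs
begin

text \<open>
  Let \<open>P = V V\<^sup>T\<close> be the orthogonal projection onto the row space of \<open>X\<close>, so \<open>X P = X\<close>, and write \<open>Dh\<close>
  for the differential of \<open>h\<close> at \<open>X\<close>.

  The reflection \<open>2 P - 1\<close> is orthogonal and fixes \<open>X\<close>.  Differentiating \<open>h (Y (2 P - 1)) = h Y\<close> at
  \<open>X\<close> gives \<open>Dh (\<eta> P) = Dh \<eta>\<close>: the constraint sees only the part of a direction that lies in the row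
  space of \<open>X\<close> (\<open>Dh_mult_P\<close>).  In particular \<open>Dh\<close> is already onto on directions of the form
  \<open>\<eta> = \<eta> P\<close>.

  The cone is then described without coordinates (\<open>bouligand_cone_iff\<close>): \<open>\<eta>\<close> is tangent to the
  intersection iff \<open>Dh \<eta> = 0\<close> and \<open>rank (X + \<eta> (1 - P)) \<le> r\<close>.

  \<^item> Necessity.  The first condition is the chain rule.  For the second, let \<open>(X\<^sub>k - X) / t\<^sub>k \<longlonglongrightarrow> \<eta>\<close>.  The
    matrices \<open>X\<^sub>k (P + t\<^sub>k\<inverse> (1 - P))\<close> have rank at most \<open>r\<close> and tend to \<open>X + \<eta> (1 - P)\<close>; the rank
    cannot jump up in a limit (\<open>rank_le_limit\<close>).
  \<^item> Sufficiency.  Let \<open>N = \<eta> (1 - P)\<close>.  Every matrix \<open>L (X + t N)\<close> has rank at most \<open>r\<close>, because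
    \<open>X + t N = (X + N) (P + t (1 - P))\<close>.  The freedom in the left factor \<open>L\<close> moves the product in all
    directions \<open>B = B P\<close> to first order, so the implicit function theorem chooses \<open>L\<close> depending
    smoothly on \<open>t\<close> with \<open>h (L (X + t N)) = 0\<close> (\<open>zero_curve\<close>).  The resulting curve has velocity \<open>\<eta>\<close>,
    which yields membership in the cone and derivability at once.

  For \<open>N = 0\<close> the same curve stays in the matrices \<open>M V\<^sup>T\<close>, that is, in a copy of the m by s matrices on
  which \<open>h\<close> is the restricted map.  Hence the tangent space of the restricted zero set at \<open>H\<close> consists
  of the \<open>K\<close> with \<open>Dh (K V\<^sup>T) = 0\<close> (\<open>tangent_space_iff\<close>).  The velocities in the definition of the
  tangent space belong to infinitely differentiable curves, so the implicit function has to be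
  shown smooth, not just differentiable.

  Finally, splitting \<open>\<eta>\<close> along \<open>V\<close>, \<open>V_perp\<close> on the right and \<open>U\<close>, \<open>U_perp\<close> on the left gives
  \<open>\<eta> P = K V\<^sup>T\<close> and \<open>\<eta> (1 - P) = U J V_perp\<^sup>T + U_perp R V_perp\<^sup>T\<close>.  The columns of \<open>X\<close> span those of \<open>U\<close>, so
  \<open>rank (X + \<eta> (1 - P)) = s + rank R\<close> (\<open>rank_add_orthogonal\<close>, \<open>rank_add_normal_iff\<close>), and the rank
  condition becomes \<open>rank R \<le> r - s\<close>.
\<close>

(* Here these names and the index notation refer to the type real^'n^'m. *)
no_notation vec_index (infixl "$" 100)
hide_const (open) Matrix.mat Matrix.rows Matrix.row Matrix.orthogonal VectorSpace.subspace Determinant.det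

section \<open>Calculus of finitely differentiable maps\<close>

text \<open>
Only the values on \<open>S\<close> matter: \<open>S\<close> is open, so derivatives at its points are determined by them.
\<close>

lemma C_k_on_cong:
  assumes "open S" "C_k_on S f k" "\<And>x. x \<in> S \<Longrightarrow> f x = g x"
  shows "C_k_on S g k"
  using assms
proof (induction k arbitrary: f g)
  case 0
  then show ?case by (simp cong: continuous_on_cong)
next
  case (Suc k)
  have D: "(g has_derivative frechet_derivative f (at x)) (at x)" if "x \<in> S" for x
  proof (rule has_derivative_transform_within_open[OF _ \<open>open S\<close> that])
    have "f differentiable (at x)" using Suc.prems(2) that by simp
    then show "(f has_derivative frechet_derivative f (at x)) (at x)"
      by (rule iffD1[OF frechet_derivative_works])
  qed (rule Suc.prems(3))
  have eq: "frechet_derivative f (at x) = frechet_derivative g (at x)" if "x \<in> S" for x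
    using frechet_derivative_at[OF D[OF that]] .
  have "C_k_on S (\<lambda>x. frechet_derivative f (at x) v) k" for v
    using Suc.prems(2) by simp
  then have "C_k_on S (\<lambda>x. frechet_derivative g (at x) v) k" for v
    by (rule Suc.IH[OF \<open>open S\<close>]) (simp only: eq)
  moreover have "\<forall>x\<in>S. g differentiable (at x)"
    using D differentiableI by blast
  ultimately show ?case
    by simp
qed

text \<open>
Frees all later arguments from \<^const>\<open>frechet_derivative\<close>: a derivative in any explicit form will do.
\<close>

lemma C_k_on_SucI:
  assumes "open S" and D: "\<And>x. x \<in> S \<Longrightarrow> (f has_derivative f' x) (at x)"
    and "\<And>v. C_k_on S (\<lambda>x. f' x v) k"
  shows "C_k_on S f (Suc k)"
proof -
  have eq: "f' x = frechet_derivative f (at x)" if "x \<in> S" for x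
    using frechet_derivative_at[OF D[OF that]] .
  have "C_k_on S (\<lambda>x. frechet_derivative f (at x) v) k" for v
    by (rule C_k_on_cong[OF assms(1) assms(3)[of v]]) (simp only: eq)
  moreover have "\<forall>x\<in>S. f differentiable (at x)"
    using D differentiableI by blast
  ultimately show ?thesis
    by simp
qed

lemma C_k_on_Suc_has_derivative:
  assumes "C_k_on S f (Suc k)" "x \<in> S"
  shows "(f has_derivative frechet_derivative f (at x)) (at x)"
proof -
  have "f differentiable (at x)" using assms by simp
  then show ?thesis by (rule iffD1[OF frechet_derivative_works])
qed

lemma C_k_on_SucD: "C_k_on S f (Suc k) \<Longrightarrow> C_k_on S f k"
proof (induction k arbitrary: f)
  case 0
  then have "continuous (at x) f" if "x \<in> S" for x
    using that differentiable_imp_continuous_within by fastforce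
  then show ?case
    by (simp add: continuous_at_imp_continuous_on)
next
  case (Suc k)
  have 1: "\<forall>x\<in>S. f differentiable (at x)"
    and 2: "C_k_on S (\<lambda>x. frechet_derivative f (at x) v) (Suc k)" for v
    using iffD1[OF C_k_on.simps(2) Suc.prems] by blast+
  have "C_k_on S (\<lambda>x. frechet_derivative f (at x) v) k" for v
    by (rule Suc.IH[OF 2])
  with 1 show ?case by simp
qed

lemma C_k_on_const: "C_k_on S (\<lambda>x. c) k"
  by (induction k arbitrary: c) simp_all

lemma C_k_on_bounded_linear:
  assumes "open S" "bounded_linear L"
  shows "C_k_on S L k"
proof (cases k)
  case 0
  then show ?thesis using assms by (simp add: linear_continuous_on)
next
  case (Suc k')
  have "C_k_on S L (Suc k')"
    by (rule C_k_on_SucI[OF assms(1) bounded_linear_imp_has_derivative[OF assms(2)] C_k_on_const])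
  then show ?thesis using Suc by simp
qed

lemma C_k_on_compose_bounded_linear:
  assumes "open S" "bounded_linear L"
  shows "C_k_on S f k \<Longrightarrow> C_k_on S (\<lambda>x. L (f x)) k"
proof (induction k arbitrary: f)
  case 0
  then show ?case
    using bounded_linear.continuous_on[OF assms(2)] by auto
next
  case (Suc k)
  note D = C_k_on_Suc_has_derivative[OF Suc.prems]
  have "C_k_on S (\<lambda>x. frechet_derivative f (at x) v) k" for v
    using Suc.prems by simp
  then show ?case
    by (intro C_k_on_SucI[OF assms(1) bounded_linear.has_derivative[OF assms(2) D]] Suc.IH)
qed

lemma C_k_on_add:
  assumes "open S"
  shows "C_k_on S f k \<Longrightarrow> C_k_on S g k \<Longrightarrow> C_k_on S (\<lambda>x. f x + g x) k"
proof (induction k arbitrary: f g)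
  case 0
  then show ?case by (auto intro: continuous_on_add)
next
  case (Suc k)
  note D = C_k_on_Suc_has_derivative[OF Suc.prems(1)] C_k_on_Suc_has_derivative[OF Suc.prems(2)]
  have "C_k_on S (\<lambda>x. frechet_derivative f (at x) v) k"
    "C_k_on S (\<lambda>x. frechet_derivative g (at x) v) k" for v
    using Suc.prems by simp_all
  then show ?case
    by (intro C_k_on_SucI[OF assms has_derivative_add[OF D]] Suc.IH)
qed

text \<open>
The product rule expresses the derivative by products of \<open>f\<close>, \<open>g\<close> and their derivatives, all of which
have one order less to supply.
\<close>

lemma C_k_on_bounded_bilinear:
  assumes "open S" and bl: "bounded_bilinear pr"
  shows "C_k_on S f k \<Longrightarrow> C_k_on S g k \<Longrightarrow> C_k_on S (\<lambda>x. pr (f x) (g x)) k"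
proof (induction k arbitrary: f g)
  case 0
  then show ?case by (auto intro: bounded_bilinear.continuous_on[OF bl])
next
  case (Suc k)
  note D = C_k_on_Suc_has_derivative[OF Suc.prems(1)] C_k_on_Suc_has_derivative[OF Suc.prems(2)]
  have "C_k_on S (\<lambda>x. frechet_derivative f (at x) v) k"
    "C_k_on S (\<lambda>x. frechet_derivative g (at x) v) k" for v
    using Suc.prems by simp_all
  then show ?case
    by (intro C_k_on_SucI[OF assms(1) bounded_bilinear.FDERIV[OF bl D]] C_k_on_add assms(1)
        Suc.IH C_k_on_SucD[OF Suc.prems(1)] C_k_on_SucD[OF Suc.prems(2)])
qed

lemmas C_k_on_mult = C_k_on_bounded_bilinear[OF _ bounded_bilinear_mult]
lemmas C_k_on_scaleR = C_k_on_bounded_bilinear[OF _ bounded_bilinear_scaleR]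

lemma C_k_on_sum:
  assumes "open S" "\<And>i. i \<in> I \<Longrightarrow> C_k_on S (f i) k"
  shows "C_k_on S (\<lambda>x. \<Sum>i\<in>I. f i x) k"
  using assms(2)
  by (induction I rule: infinite_finite_induct) (auto intro: C_k_on_const C_k_on_add assms(1))

lemma C_k_on_prod:
  fixes f :: "'i \<Rightarrow> 'a::real_normed_vector \<Rightarrow> real"
  assumes "open S" "\<And>i. i \<in> I \<Longrightarrow> C_k_on S (f i) k"
  shows "C_k_on S (\<lambda>x. \<Prod>i\<in>I. f i x) k"
  using assms(2)
  by (induction I rule: infinite_finite_induct) (auto intro: C_k_on_const C_k_on_mult assms(1))

text \<open>
The derivative \<open>- f' / f\<^sup>2\<close> contains the reciprocal itself, but one order lower, so induction applies.
\<close>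

lemma C_k_on_inverse:
  fixes f :: "'a::real_normed_vector \<Rightarrow> real"
  assumes "open S" "\<And>x. x \<in> S \<Longrightarrow> f x \<noteq> 0"
  shows "C_k_on S f k \<Longrightarrow> C_k_on S (\<lambda>x. inverse (f x)) k"
proof (induction k)
  case 0
  then show ?case using assms by (auto intro: continuous_on_inverse)
next
  case (Suc k)
  note * = Suc.IH[OF C_k_on_SucD[OF Suc.prems]]
  have "C_k_on S (\<lambda>x. frechet_derivative f (at x) v) k" for v
    using Suc.prems by simp
  then have "C_k_on S (\<lambda>x. (-1) * (inverse (f x) * frechet_derivative f (at x) v * inverse (f x))) k" for v
    by (intro C_k_on_mult C_k_on_const * assms(1))
  then have "C_k_on S (\<lambda>x. - (inverse (f x) * frechet_derivative f (at x) v * inverse (f x))) k" for v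
    by simp
  then show ?case
    by (intro C_k_on_SucI[OF assms(1) Deriv.has_derivative_inverse[OF assms(2) C_k_on_Suc_has_derivative[OF Suc.prems]]])
qed

lemma C_k_on_euclidean:
  fixes f :: "'a::real_normed_vector \<Rightarrow> 'b::euclidean_space"
  assumes "open S"
  shows "C_k_on S f k \<longleftrightarrow> (\<forall>b\<in>Basis. C_k_on S (\<lambda>x. inner (f x) b) k)"
proof
  assume "C_k_on S f k"
  then show "\<forall>b\<in>Basis. C_k_on S (\<lambda>x. inner (f x) b) k"
    using C_k_on_compose_bounded_linear[OF assms bounded_linear_inner_left] by blast
next
  assume "\<forall>b\<in>Basis. C_k_on S (\<lambda>x. inner (f x) b) k"
  then have "C_k_on S (\<lambda>x. \<Sum>b\<in>Basis. inner (f x) b *\<^sub>R b) k"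
    by (auto intro!: C_k_on_sum C_k_on_scaleR C_k_on_const assms)
  then show "C_k_on S f k"
    by (simp add: euclidean_representation)
qed

text \<open>
The map \<open>x \<mapsto> Dg (f x) (Df x v)\<close> depends on \<open>x\<close> through both the base point and the argument.  Expanding
\<open>Df x v\<close> in the standard basis turns it into a sum of products of coordinates of \<open>Df x v\<close> with the
compositions of the partial derivatives of \<open>g\<close> with \<open>f\<close>.  The induction therefore keeps \<open>f\<close> fixed and
lets \<open>g\<close> vary.
\<close>

lemma C_k_on_compose:
  fixes f :: "'a::real_normed_vector \<Rightarrow> 'b::euclidean_space" and g :: "'b \<Rightarrow> 'c::real_normed_vector"
  assumes "open S"
  shows "C_k_on S f k \<Longrightarrow> C_k_on UNIV g k \<Longrightarrow> C_k_on S (\<lambda>x. g (f x)) k"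
proof (induction k arbitrary: g)
  case 0
  then show ?case
    by (auto intro: continuous_on_compose2)
next
  case (Suc k)
  have expand: "frechet_derivative g (at y) w =
      (\<Sum>b\<in>Basis. inner w b *\<^sub>R frechet_derivative g (at y) b)" for y w
  proof -
    have "linear (frechet_derivative g (at y))"
      using Suc.prems(2) by (auto intro: linear_frechet_derivative)
    then have "frechet_derivative g (at y) (\<Sum>b\<in>Basis. inner w b *\<^sub>R b) =
      (\<Sum>b\<in>Basis. inner w b *\<^sub>R frechet_derivative g (at y) b)"
      by (simp add: linear_sum linear_cmul)
    then show ?thesis by (simp add: euclidean_representation)
  qed
  show ?case
  proof (rule C_k_on_SucI[where f' = "\<lambda>x v. frechet_derivative g (at (f x)) (frechet_derivative f (at x) v)", OF assms(1)])
    fix x assume "x \<in> S"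
    then have "(f has_derivative frechet_derivative f (at x)) (at x)"
      "(g has_derivative frechet_derivative g (at (f x))) (at (f x))"
      using Suc.prems by (auto intro: C_k_on_Suc_has_derivative)
    then show "((\<lambda>x. g (f x)) has_derivative (\<lambda>v. frechet_derivative g (at (f x)) (frechet_derivative f (at x) v))) (at x)"
      by (rule has_derivative_compose)
  next
    fix v
    have "C_k_on S (\<lambda>x. inner (frechet_derivative f (at x) v) b) k" for b
      using Suc.prems C_k_on_compose_bounded_linear[OF assms bounded_linear_inner_left, of "\<lambda>x. frechet_derivative f (at x) v"]
      by auto
    moreover have "C_k_on S (\<lambda>x. frechet_derivative g (at (f x)) b) k" for b
      using Suc.prems C_k_on_SucD[OF Suc.prems(1)] by (intro Suc.IH) auto
    ultimately have "C_k_on S (\<lambda>x. \<Sum>b\<in>Basis. inner (frechet_derivative f (at x) v) b *\<^sub>R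
        frechet_derivative g (at (f x)) b) k"
      by (intro C_k_on_sum C_k_on_scaleR assms(1))
    then show "C_k_on S (\<lambda>x. frechet_derivative g (at (f x)) (frechet_derivative f (at x) v)) k"
      by (rule C_k_on_cong[OF assms(1)]) (rule expand[symmetric])
  qed
qed

section \<open>Smooth implicit curves\<close>

lemma C_k_on_det:
  fixes A :: "'a::real_normed_vector \<Rightarrow> real^'q^'q"
  assumes "open S" "\<And>i j. C_k_on S (\<lambda>x. A x $ i $ j) k"
  shows "C_k_on S (\<lambda>x. Determinants.det (A x)) k"
  unfolding Determinants.det_def
proof (rule C_k_on_sum[OF assms(1)], rule C_k_on_mult[OF assms(1) C_k_on_const])
  show "C_k_on S (\<lambda>x. \<Prod>i\<in>UNIV. A x $ i $ p i) k" for p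
    by (rule C_k_on_prod[OF assms])
qed

text \<open>
By Cramer's rule the solution is a quotient of polynomials in the coefficients and the right-hand
side.
\<close>

lemma C_k_on_linear_system_solution:
  fixes A :: "'a::real_normed_vector \<Rightarrow> real^'q^'q"
  assumes S: "open S" and A: "\<And>i j. C_k_on S (\<lambda>x. A x $ i $ j) k"
    and b: "\<And>i. C_k_on S (\<lambda>x. b x $ i) k"
    and inj: "\<And>x v. x \<in> S \<Longrightarrow> A x *v v = 0 \<Longrightarrow> v = 0"
    and sol: "\<And>x. x \<in> S \<Longrightarrow> A x *v w x = b x"
  shows "C_k_on S w k"
proof -
  have det: "Determinants.det (A x) \<noteq> 0" if "x \<in> S" for x
    using inj[OF that] matrix_left_invertible_ker invertible_det_nz invertible_left_inverse by blast
  define W where "W x = (\<chi> l. Determinants.det (\<chi> i j. if j = l then b x $ i else A x $ i $ j) *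
      inverse (Determinants.det (A x)))" for x
  have W: "W x = w x" if "x \<in> S" for x
    using cramer[OF det[OF that]] sol[OF that] by (simp add: W_def divide_inverse)
  have entry: "C_k_on S (\<lambda>x. if j = l then b x $ i else A x $ i $ j) k" for i j l
    using A b by (cases "j = l") simp_all
  have "C_k_on S (\<lambda>x. Determinants.det (\<chi> i j. if j = l then b x $ i else A x $ i $ j)) k" for l
    by (rule C_k_on_det[OF S]) (simp only: vec_lambda_beta entry)
  then have "C_k_on S (\<lambda>x. W x $ l) k" for l
    unfolding W_def vec_lambda_beta
    by (rule C_k_on_mult[OF S _ C_k_on_inverse[OF S det C_k_on_det[OF S A]]])
  then have "C_k_on S W k"
    by (intro iffD2[OF C_k_on_euclidean[OF S]]) (auto simp: Basis_vec_def inner_axis)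
  then show ?thesis
    by (rule C_k_on_cong[OF S]) (rule W)
qed

text \<open>
Differentiating \<open>F (t, u t) = 0\<close> shows that the velocity \<open>w\<close> of \<open>u\<close> solves a linear system whose
coefficients are partial derivatives of \<open>F\<close> along the curve.  If \<open>u\<close> is k times continuously
differentiable, then so are these coefficients, hence \<open>w\<close>, and so \<open>u\<close> is one order better.  Continuity
starts the induction.
\<close>

lemma smooth_on_implicit_curve:
  fixes F :: "real \<times> (real^'q) \<Rightarrow> real^'q"
  assumes I: "open I" and smooth: "smooth_on UNIV F"
    and Du: "\<And>t. t \<in> I \<Longrightarrow> (u has_derivative (\<lambda>v. v *\<^sub>R w t)) (at t)"
    and eq: "\<And>t. t \<in> I \<Longrightarrow> frechet_derivative F (at (t, u t)) (1, w t) = 0"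
    and inj: "\<And>t v. t \<in> I \<Longrightarrow> frechet_derivative F (at (t, u t)) (0, v) = 0 \<Longrightarrow> v = 0"
  shows "smooth_on I u"
proof -
  have CF: "C_k_on UNIV F (Suc k)" for k
    using smooth by (simp only: smooth_on_def)
  have CD: "C_k_on UNIV (\<lambda>z. frechet_derivative F (at z) v) k" for v k
    using CF[of k] unfolding C_k_on.simps by blast
  have lin: "linear (frechet_derivative F (at z))" for z
    using has_derivative_linear[OF C_k_on_Suc_has_derivative[OF CF]] by blast
  define M where "M t = matrix (\<lambda>v. frechet_derivative F (at (t, u t)) (0, v))" for t
  have "linear (\<lambda>v. frechet_derivative F (at (t, u t)) (0, v))" for t
    using linear_compose[OF _ lin, of "\<lambda>v. (0, v)"] by (simp add: o_def linear_iff)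
  then have M: "M t *v v = frechet_derivative F (at (t, u t)) (0, v)" for t v
    unfolding M_def by (intro matrix_works) (simp only: linear_matrix_vector_mul_eq)
  have injM: "v = 0" if "t \<in> I" "M t *v v = 0" for t v
    using inj[OF that(1)] that(2) unfolding M .
  have sol: "M t *v w t = - frechet_derivative F (at (t, u t)) (1, 0)" if "t \<in> I" for t
  proof -
    have "frechet_derivative F (at (t, u t)) ((0, w t) + (1, 0)) = 0"
      using eq[OF that] by simp
    then show ?thesis
      unfolding linear_add[OF lin] M by (simp only: eq_neg_iff_add_eq_0)
  qed
  have "C_k_on I u k" for k
  proof (induction k)
    case 0
    have "continuous (at t) u" if "t \<in> I" for t
      using has_derivative_continuous[OF Du[OF that]] .
    then show ?case
      by (simp add: continuous_at_imp_continuous_on)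
  next
    case (Suc k)
    have "bounded_linear (\<lambda>t::real. (t, 0::real^'q))" "bounded_linear (\<lambda>v::real^'q. (0::real, v))"
      by (intro bounded_linear_Pair bounded_linear_ident bounded_linear_zero)+
    then have "C_k_on I (\<lambda>t. (t, 0) + (0, u t)) k"
      by (intro C_k_on_add[OF I C_k_on_bounded_linear[OF I]]
          C_k_on_compose_bounded_linear[OF I, of "\<lambda>v. (0, v)" u] Suc)
    then have curve: "C_k_on I (\<lambda>t. (t, u t)) k"
      by simp
    have comp: "C_k_on I (\<lambda>t. frechet_derivative F (at (t, u t)) v $ i) k" for v i
      by (rule C_k_on_compose_bounded_linear[OF I bounded_linear_vec_nth C_k_on_compose[OF I curve CD]])
    have "C_k_on I w k"
    proof (rule C_k_on_linear_system_solution[of I M k "\<lambda>t. - frechet_derivative F (at (t, u t)) (1, 0)"])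
      fix i j
      show "C_k_on I (\<lambda>t. M t $ i $ j) k"
        using comp[of "(0, axis j 1)" i] by (simp only: M_def matrix_def vec_lambda_beta)
      show "C_k_on I (\<lambda>t. (- frechet_derivative F (at (t, u t)) (1, 0)) $ i) k"
        using C_k_on_mult[OF I C_k_on_const[of _ "-1"] comp[of "(1, 0)" i]]
        by (simp only: vector_uminus_component mult_minus1)
    qed (fact I injM sol)+
    then have "C_k_on I (\<lambda>t. v *\<^sub>R w t) k" for v
      by (rule C_k_on_scaleR[OF I C_k_on_const])
    then show "C_k_on I u (Suc k)"
      by (rule C_k_on_SucI[OF I Du, rotated])
  qed
  then show ?thesis
    by (simp only: smooth_on_def simp_thms)
qed

text \<open>
The implicit function theorem for one real parameter, normalized at the origin: the partial
derivative in \<open>u\<close> is the identity and the one in \<open>t\<close> vanishes, so \<open>u\<close> starts with velocity 0.  The map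
\<open>(t, u) \<mapsto> (t, F (t, u))\<close> then has the identity as its derivative at the origin, and \<open>u t\<close> is read off
its local inverse at \<open>(t, 0)\<close>.
\<close>

lemma smooth_implicit_curve:
  fixes F :: "real \<times> (real^'q) \<Rightarrow> real^'q"
  assumes smooth: "smooth_on UNIV F" and F0: "F (0, 0) = 0"
    and DF0: "(F has_derivative snd) (at (0, 0))"
  obtains \<epsilon> u where "\<epsilon> > 0" "u 0 = 0" "\<And>t. t \<in> {-\<epsilon><..<\<epsilon>} \<Longrightarrow> F (t, u t) = 0"
    "smooth_on {-\<epsilon><..<\<epsilon>} u" "(u has_vector_derivative 0) (at 0)"
proof -
  define DF where "DF z = frechet_derivative F (at z)" for z
  have C: "C_k_on UNIV F k" for k
    using smooth by (simp add: smooth_on_def)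
  have CD: "C_k_on UNIV (\<lambda>z. DF z v) k" for v k
    using C[of "Suc k"] unfolding DF_def C_k_on.simps by blast
  have DF: "(F has_derivative DF z) (at z)" for z
    using C_k_on_Suc_has_derivative[OF C] unfolding DF_def by blast
  have DF00: "DF (0, 0) = snd"
    using has_derivative_unique[OF DF DF0] .
  define \<Psi> where "\<Psi> z = (fst z, F z)" for z
  have D\<Psi>: "(\<Psi> has_derivative (\<lambda>v. (fst v, DF z v))) (at z)" for z
    unfolding \<Psi>_def by (intro has_derivative_Pair has_derivative_fst has_derivative_ident DF)
  define P where "P z = Blinfun (\<lambda>v. (fst v, DF z v))" for z
  have P: "blinfun_apply (P z) = (\<lambda>v. (fst v, DF z v))" for z
    unfolding P_def by (rule bounded_linear_Blinfun_apply) (rule has_derivative_bounded_linear[OF D\<Psi>])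
  have contP: "continuous_on UNIV P"
    by (rule continuous_on_blinfun_componentwise)
      (use CD[of _ 0] in \<open>auto simp: P intro!: continuous_on_Pair continuous_on_const\<close>)
  have DP: "(\<Psi> has_derivative blinfun_apply (P z)) (at z)" for z
    using D\<Psi> by (simp only: P)
  have idP: "id_blinfun o\<^sub>L P (0, 0) = id_blinfun"
    by (rule blinfun_eqI) (simp add: P DF00)
  obtain U V g g' where "open U" "U \<subseteq> UNIV" and U: "(0, 0) \<in> U" and V: "open V" "\<Psi> (0, 0) \<in> V"
    and hom: "homeomorphism U V \<Psi> g"
    and g': "\<And>y. y \<in> V \<Longrightarrow> (g has_derivative g' y) (at y)"
      "\<And>y. y \<in> V \<Longrightarrow> g' y = inv_into UNIV (blinfun_apply (P (g y)))"
      "\<And>y. y \<in> V \<Longrightarrow> bij (blinfun_apply (P (g y)))"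
    by (rule inverse_function_theorem[OF open_UNIV DP contP UNIV_I idP]) (rule that)
  have "(0, 0) \<in> V"
    using V(2) by (simp add: \<Psi>_def F0)
  then obtain \<epsilon> where \<epsilon>: "\<epsilon> > 0" "ball (0, 0) \<epsilon> \<subseteq> V"
    using V(1) open_contains_ball by blast
  define I where "I = {-\<epsilon><..<\<epsilon>}"
  have I: "open I" "0 \<in> I"
    using \<epsilon> by (auto simp: I_def)
  have inV: "(t, 0) \<in> V" if "t \<in> I" for t
  proof -
    have "(t, 0::real^'q) \<in> ball (0, 0) \<epsilon>"
      using that by (auto simp: I_def dist_Pair_Pair dist_real_def)
    then show ?thesis using \<epsilon>(2) by blast
  qed
  define u where "u t = snd (g (t, 0))" for t
  have \<Psi>g: "\<Psi> (g (t, 0)) = (t, 0)" if "t \<in> I" for t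
    using hom inV[OF that] by (simp add: homeomorphism_def)
  have g: "g (t, 0) = (t, u t)" if "t \<in> I" for t
    using \<Psi>g[OF that] by (simp add: \<Psi>_def u_def prod_eq_iff)
  have Fu: "F (t, u t) = 0" if "t \<in> I" for t
    using \<Psi>g[OF that] unfolding g[OF that] by (simp add: \<Psi>_def)
  have "g (\<Psi> (0, 0)) = (0, 0)"
    using hom U unfolding homeomorphism_def by blast
  then have u0: "u 0 = 0"
    by (simp add: u_def \<Psi>_def F0)
  define w where "w t = snd (g' (t, 0) (1, 0))" for t
  have w: "DF (t, u t) (1, w t) = 0" if "t \<in> I" for t
  proof -
    have "blinfun_apply (P (g (t, 0))) (g' (t, 0) (1, 0)) = (1, 0)"
      using g'(2,3)[OF inV[OF that]] by (simp add: bij_is_surj surj_f_inv_f)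
    moreover from this have "g' (t, 0) (1, 0) = (1, w t)"
      by (simp add: P w_def prod_eq_iff)
    ultimately show ?thesis
      using g[OF that] by (simp add: P)
  qed
  have Du: "(u has_derivative (\<lambda>v. v *\<^sub>R w t)) (at t)" if "t \<in> I" for t
  proof -
    have "((\<lambda>t. (t, 0)) has_derivative (\<lambda>v. (v, 0))) (at t)"
      by (intro derivative_eq_intros) auto
    from has_derivative_compose[OF this g'(1)[OF inV[OF that]]]
    have "(u has_derivative (\<lambda>v. snd (g' (t, 0) (v, 0)))) (at t)"
      unfolding u_def by (rule has_derivative_snd)
    moreover have "snd (g' (t, 0) (v, 0)) = v *\<^sub>R w t" for v
      using linear_cmul[OF has_derivative_linear[OF g'(1)[OF inV[OF that]]], of v "(1, 0)"]
      by (simp add: w_def)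
    ultimately show ?thesis by (simp only:)
  qed
  have lin: "linear (DF z)" for z
    using has_derivative_linear[OF DF] .
  have inj: "v = 0" if "t \<in> I" "DF (t, u t) (0, v) = 0" for t v
  proof -
    have "blinfun_apply (P (g (t, 0))) (0, v) = blinfun_apply (P (g (t, 0))) (0, 0)"
      using that(2) linear_0[OF lin, of "(t, u t)"] unfolding P g[OF that(1)] by (simp add: zero_prod_def)
    then show ?thesis
      using bij_is_inj[OF g'(3)[OF inV[OF that(1)]]] by (simp add: inj_eq)
  qed
  have "smooth_on I u"
    by (rule smooth_on_implicit_curve[OF I(1) smooth Du w[unfolded DF_def] inj[unfolded DF_def]])
  moreover have "w 0 = 0"
    using w[OF I(2)] unfolding u0 DF00 snd_conv .
  then have "(u has_vector_derivative 0) (at 0)"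
    using Du[OF I(2)] unfolding has_vector_derivative_def by (simp only:)
  ultimately show thesis
    using \<epsilon>(1) u0 Fu that[of \<epsilon> u] unfolding I_def by blast
qed

section \<open>Rank, limits and orthogonal projections\<close>

lemma matrix_add_rdistrib: "(A + B) ** C = A ** C + B ** C"
  by (simp add: Finite_Cartesian_Product.vec_eq_iff matrix_matrix_mult_def distrib_right sum.distrib)

lemma bounded_bilinear_matrix_mult:
  "bounded_bilinear ((**) :: real^'n^'m \<Rightarrow> real^'p^'n \<Rightarrow> real^'p^'m)"
  unfolding bilinear_conv_bounded_bilinear[symmetric] bilinear_def
  by (simp add: linear_iff matrix_add_ldistrib matrix_add_rdistrib matrix_scalar_ac scalar_matrix_assoc)

lemma bounded_bilinear_matrix_vector_mult:
  "bounded_bilinear ((*v) :: real^'n^'m \<Rightarrow> real^'n \<Rightarrow> real^'m)"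
  unfolding bilinear_conv_bounded_bilinear[symmetric] bilinear_def
  by (simp add: linear_iff matrix_vector_right_distrib matrix_vector_mult_add_rdistrib
      matrix_vector_mult_scaleR scaleR_matrix_vector_assoc)

lemmas bounded_linear_matrix_mult_left = bounded_bilinear.bounded_linear_left[OF bounded_bilinear_matrix_mult]
lemmas matrix_mult_diff_left = bounded_bilinear.diff_left[OF bounded_bilinear_matrix_mult]
lemmas matrix_mult_diff_right = bounded_bilinear.diff_right[OF bounded_bilinear_matrix_mult]
lemmas matrix_mult_scaleR_left = bounded_bilinear.scaleR_left[OF bounded_bilinear_matrix_mult]
lemmas matrix_mult_scaleR_right = bounded_bilinear.scaleR_right[OF bounded_bilinear_matrix_mult]
lemmas tendsto_matrix_mult = bounded_bilinear.tendsto[OF bounded_bilinear_matrix_mult]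

lemma inner_matrix_vector_mult:
  fixes A :: "real^'n^'m"
  shows "inner (A *v x) y = inner x (transpose A *v y)"
  using dot_lmul_matrix[of x "transpose A" y] by (simp only: vector_transpose_matrix)

text \<open>
Lower semicontinuity of the rank.  The limit \<open>L\<close> is injective on its row space \<open>T\<close>, hence bounded below
there, and a matrix close enough to \<open>L\<close> remains injective on \<open>T\<close>; its rank is then at least
\<open>dim T = rank L\<close>.
\<close>

lemma rank_le_limit:
  fixes Z :: "nat \<Rightarrow> real^'n^'m"
  assumes lim: "Z \<longlonglongrightarrow> L" and rank: "\<And>k. rank (Z k) \<le> r"
  shows "rank L \<le> r"
proof -
  define T where "T = span (rows L)"
  have "\<forall>v\<in>T. L *v v = 0 \<longrightarrow> v = 0"
    unfolding T_def using nullspace_inter_rowspace by blast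
  then obtain e where e: "e > 0" "\<And>v. v \<in> T \<Longrightarrow> e * norm v \<le> norm (L *v v)"
    using injective_imp_isometric[of T "(*v) L"] closed_span[of "rows L"] subspace_span[of "rows L"]
    unfolding T_def by auto
  obtain C where C: "C > 0" "\<And>(A :: real^'n^'m) v. norm (A *v v) \<le> norm A * norm v * C"
    using bounded_bilinear.pos_bounded[OF bounded_bilinear_matrix_vector_mult] by blast
  obtain k where k: "norm (Z k - L) < e / C"
    using LIMSEQ_D[OF lim, of "e / C"] e C by auto
  have ker: "v = 0" if "v \<in> T" "Z k *v v = 0" for v
  proof (rule ccontr)
    assume "v \<noteq> 0"
    have "e * norm v \<le> norm ((Z k - L) *v v)"
      using e(2)[OF that(1)] that(2) by (simp add: matrix_vector_mult_diff_rdistrib)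
    also have "\<dots> \<le> norm (Z k - L) * norm v * C"
      by (rule C(2))
    also have "\<dots> < (e / C) * norm v * C"
      using k C(1) \<open>v \<noteq> 0\<close> by (intro mult_strict_right_mono) simp_all
    finally show False using C(1) by simp
  qed
  have "inj_on ((*v) (Z k)) T"
  proof (rule inj_onI)
    fix x y assume "x \<in> T" "y \<in> T" "Z k *v x = Z k *v y"
    then have "x - y = 0"
      by (intro ker) (simp_all add: T_def span_diff matrix_vector_mult_diff_distrib)
    then show "x = y" by simp
  qed
  then have "dim ((*v) (Z k) ` T) = dim T"
    using dim_image_eq[OF matrix_vector_mul_linear, of "Z k" T] by (simp add: T_def span_span)
  then have "rank L = dim ((*v) (Z k) ` T)"
    by (simp add: T_def row_rank_def)
  also have "\<dots> \<le> rank (Z k)"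
    unfolding rank_dim_range by (intro dim_subset) auto
  finally show ?thesis using rank[of k] by simp
qed

text \<open>
Here \<open>Q\<close> is the orthogonal projection onto the column space of \<open>X\<close>.  Since \<open>X v = (X + N) (P v)\<close>, the
range of \<open>X + N\<close> contains that of \<open>X\<close>; modulo the latter only the part \<open>(1 - Q) N\<close> of \<open>N\<close> remains, and its
range is orthogonal to that of \<open>X\<close>.
\<close>

lemma rank_add_orthogonal:
  fixes X N :: "real^'n^'m"
  assumes XP: "X ** P = X" and NP: "N ** P = 0"
    and Q: "Q = X ** Y" "transpose Q = Q" "Q ** X = X"
  shows "rank (X + N) = rank X + rank (N - Q ** N)"
proof -
  define M where "M = N - Q ** N"
  have "Q ** Q = Q"
    using Q(1,3) by (simp add: matrix_mul_assoc)
  then have QM: "Q ** M = 0"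
    by (simp add: M_def matrix_mult_diff_right matrix_mul_assoc)
  have orth: "inner x y = 0" if xy: "x \<in> range ((*v) X)" "y \<in> range ((*v) M)" for x y
  proof -
    obtain v w where "x = X *v v" and y: "y = M *v w"
      using xy by blast
    then have "x = Q *v x"
      using Q(3) by (simp add: matrix_vector_mul_assoc)
    then have "inner x y = inner (Q *v x) y"
      by simp
    also have "\<dots> = inner x (Q *v y)"
      unfolding inner_matrix_vector_mult Q(2) ..
    also have "\<dots> = 0"
      using QM by (simp add: y matrix_vector_mul_assoc)
    finally show ?thesis .
  qed
  have sub: "subspace (range ((*v) (X + N)))"
    by (intro linear_subspace_image matrix_vector_mul_linear subspace_UNIV)
  have X_in: "X *v v \<in> range ((*v) (X + N))" for v
  proof -
    have "X *v v = (X + N) *v (P *v v)"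
      using XP NP by (simp add: matrix_vector_mul_assoc matrix_add_rdistrib)
    then show ?thesis by blast
  qed
  have M_in: "M *v v \<in> range ((*v) (X + N))" for v
  proof -
    have "M *v v = (X + N) *v v - X *v v - X *v (Y *v (N *v v))"
      by (simp add: M_def Q(1) matrix_vector_mult_add_rdistrib matrix_vector_mult_diff_rdistrib
          matrix_vector_mul_assoc matrix_mul_assoc)
    then show ?thesis
      using subspace_diff[OF sub] X_in by auto
  qed
  have "span (range ((*v) (X + N))) = span (range ((*v) X) \<union> range ((*v) M))"
  proof (rule span_eq[THEN iffD2], intro conjI subsetI)
    fix x assume "x \<in> range ((*v) (X + N))"
    then obtain v where "x = (X + N) *v v" by blast
    then have "x = X *v (v + Y *v (N *v v)) + M *v v"
      by (simp add: M_def Q(1) matrix_vector_mult_diff_rdistrib matrix_vector_mul_assoc matrix_mul_assoc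
          matrix_vector_mult_add_rdistrib matrix_vector_right_distrib)
    then show "x \<in> span (range ((*v) X) \<union> range ((*v) M))"
      by (simp only:) (intro span_add span_base; blast)
  next
    fix x assume "x \<in> range ((*v) X) \<union> range ((*v) M)"
    then show "x \<in> span (range ((*v) (X + N)))"
      using X_in M_in by (auto intro!: span_base)
  qed
  then have "dim (range ((*v) (X + N))) = dim (range ((*v) X) \<union> range ((*v) M))"
    using dim_span[of "range ((*v) (X + N))"] dim_span[of "range ((*v) X) \<union> range ((*v) M)"]
    by (simp only:)
  also have "\<dots> = dim (range ((*v) X)) + dim (range ((*v) M))"
    by (rule dim_orthogonal_sum) (rule orth)
  finally show ?thesis
    by (simp add: rank_dim_range M_def)
qed

text \<open>
On its row space \<open>X\<close> is injective and so has a left inverse \<open>G\<close>.  As \<open>X\<close> kills the orthogonal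
complement of the row space, \<open>G X\<close> is the orthogonal projection.
\<close>

lemma row_space_projection_exists:
  fixes X :: "real^'n^'m"
  obtains P G where "transpose P = P" "X ** P = X" "P = G ** X"
proof -
  define T where "T = span (rows X)"
  have T: "subspace T"
    unfolding T_def by (rule subspace_span)
  have "inj_on ((*v) X) T"
    unfolding T_def using matrix_vector_mul_injective_on_rowspace by (auto intro!: inj_onI)
  then obtain g where g: "range g \<subseteq> T" "linear g" "\<And>v. v \<in> T \<Longrightarrow> g (X *v v) = v"
    using linear_exists_left_inverse_on[OF matrix_vector_mul_linear T] by blast
  define G where "G = matrix g"
  have G: "G *v y = g y" for y
    unfolding G_def using g(2) by (intro matrix_works) (simp only: linear_matrix_vector_mul_eq)
  define P where "P = G ** X"
  have P: "P *v v = g (X *v v)" for v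
    by (simp add: P_def G flip: matrix_vector_mul_assoc)
  have PT: "P *v v \<in> T" for v
    using g(1) by (auto simp: P)
  obtain p where p: "\<And>v. p v \<in> T" "\<And>v. X *v (v - p v) = 0"
  proof -
    have "\<exists>y\<in>T. X *v (v - y) = 0" for v
    proof -
      obtain y z where yz: "y \<in> T" "\<And>w. w \<in> T \<Longrightarrow> orthogonal z w" "v = y + z"
        using orthogonal_subspace_decomp_exists[of "rows X" v] unfolding T_def by blast
      have "X *v z = 0"
      proof (subst Finite_Cartesian_Product.vec_eq_iff, intro allI)
        fix i
        have "orthogonal z (row i X)"
          by (rule yz(2)) (auto simp: T_def Finite_Cartesian_Product.rows_def intro!: span_base)
        then show "(X *v z) $ i = 0 $ i"
          by (simp add: matrix_vector_mult_def real_inner_class.orthogonal_def inner_vec_def Finite_Cartesian_Product.row_def mult.commute)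
      qed
      then have "X *v (v - y) = 0" using yz(3) by simp
      then show ?thesis using yz(1) by blast
    qed
    then have "\<forall>v. \<exists>y. y \<in> T \<and> X *v (v - y) = 0" by blast
    from choice[OF this] show thesis using that by blast
  qed
  have Pp: "P *v v = p v" for v
  proof -
    have "X *v v = X *v p v"
      using p(2)[of v] by (simp add: matrix_vector_mult_diff_distrib)
    then show ?thesis by (simp add: P g(3)[OF p(1)])
  qed
  have XP: "X ** P = X"
    unfolding matrix_eq using p(2) by (simp add: Pp matrix_vector_mult_diff_distrib flip: matrix_vector_mul_assoc)
  have orth: "inner (P *v v) (w - P *v w) = 0" for v w
    using orthogonal_nullspace_rowspace[OF p(2), of "P *v v" w] PT[of v]
    by (simp add: Pp T_def real_inner_class.orthogonal_def inner_commute[of "w - p w" "p v"])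
  have "inner (P *v v) w = inner v (P *v w)" for v w
    using orth[of v w] orth[of w v] by (simp add: inner_diff_right inner_commute)
  then have "inner (transpose P *v v) w = inner (P *v v) w" for v w
    unfolding inner_matrix_vector_mult[of "transpose P"] transpose_transpose by simp
  then have "transpose P *v v = P *v v" for v
    using vector_eq_rdot[of "transpose P *v v" "P *v v"] by blast
  then have "transpose P = P"
    by (simp add: matrix_eq)
  with XP that show thesis
    unfolding P_def by blast
qed

section \<open>The tangent cone in terms of the row space projection\<close>

text \<open>
\<open>P\<close> is the orthogonal projection onto the row space of \<open>X\<close>, and \<open>G\<close> is a left inverse of \<open>X\<close> there.
\<close>

locale regular_invariant_zero =
  fixes h :: "real^'n^'m \<Rightarrow> real^'q" and X :: "real^'n^'m" and P :: "real^'n^'n" and G :: "real^'m^'n"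
  assumes smooth: "smooth_on UNIV h" and invariant: "orthogonally_invariant h"
    and zero: "h X = 0" and regular: "dim (range (frechet_derivative h (at X))) = CARD('q)"
    and P_sym: "transpose P = P" and XP: "X ** P = X" and P_eq: "P = G ** X"
begin

definition Dh :: "real^'n^'m \<Rightarrow> real^'q" where
  "Dh = frechet_derivative h (at X)"

lemma C_k_h: "C_k_on UNIV h k"
  using smooth by (simp only: smooth_on_def)

lemma h_has_derivative: "(h has_derivative Dh) (at X)"
  unfolding Dh_def by (rule C_k_on_Suc_has_derivative[OF C_k_h UNIV_I])

lemma bounded_linear_Dh: "bounded_linear Dh"
  by (rule has_derivative_bounded_linear[OF h_has_derivative])

lemma linear_Dh: "linear Dh"
  by (rule bounded_linear.linear[OF bounded_linear_Dh])

lemma surj_Dh: "surj Dh"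
proof -
  have "subspace (range Dh)"
    by (intro linear_subspace_image linear_Dh subspace_UNIV)
  moreover have "dim (range Dh) = dim (UNIV :: (real^'q) set)"
    using regular by (simp add: Dh_def)
  ultimately show ?thesis
    using subspace_dim_equal[of "range Dh" UNIV] by simp
qed

lemma P_idem: "P ** P = P"
  unfolding P_eq by (simp add: XP[unfolded P_eq] flip: matrix_mul_assoc)

lemma diff_mult_P: "(A - A ** P) ** P = 0"
  by (simp add: matrix_mult_diff_left P_idem flip: matrix_mul_assoc)

text \<open>
The reflection \<open>Q = P - (1 - P)\<close> is orthogonal with \<open>X Q = X\<close>, so differentiating the invariance
\<open>h (Y Q) = h Y\<close> at \<open>X\<close> gives \<open>Dh (A Q) = Dh A\<close>.  Since \<open>A Q = 2 A P - A\<close>, this is the claim.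
\<close>

lemma Dh_mult_P: "Dh (A ** P) = Dh A"
proof -
  \<comment> \<open>Kept as a difference of projections, which multiply to 0, rather than as \<open>2 P - 1\<close>.\<close>
  define N where "N = mat 1 - P"
  define Q where "Q = P - N"
  have "transpose N = N"
    unfolding N_def using P_sym
    by (simp add: Finite_Cartesian_Product.vec_eq_iff transpose_def Finite_Cartesian_Product.mat_def)
  then have "transpose Q = Q"
    unfolding Q_def using P_sym by (simp add: Finite_Cartesian_Product.vec_eq_iff transpose_def)
  moreover have "P ** N = 0" "N ** P = 0" "N ** N = N"
    by (simp_all add: N_def matrix_mult_diff_left matrix_mult_diff_right P_idem)
  then have "Q ** Q = P + N"
    by (simp add: Q_def matrix_mult_diff_left matrix_mult_diff_right P_idem)
  then have "Q ** Q = mat 1"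
    by (simp add: N_def)
  ultimately have "orthogonal_matrix Q"
    by (simp add: orthogonal_matrix)
  then have inv: "h (Y ** Q) = h Y" for Y
    using invariant by (simp add: orthogonally_invariant_def)
  have AQ: "A ** Q = A ** P - (A - A ** P)" for A :: "real^'n^'m"
    by (simp only: Q_def N_def matrix_mult_diff_right matrix_mul_rid)
  have XQ: "X ** Q = X"
    unfolding AQ XP by simp
  have "((\<lambda>Y. Y ** Q) has_derivative (\<lambda>Y. Y ** Q)) (at X)"
    by (rule bounded_linear_imp_has_derivative[OF bounded_linear_matrix_mult_left])
  from has_derivative_compose[OF this, of h Dh] h_has_derivative
  have "(h has_derivative (\<lambda>Y. Dh (Y ** Q))) (at X)"
    by (simp only: XQ inv)
  then have "Dh (A ** Q) = Dh A"
    using has_derivative_unique[OF h_has_derivative] by metis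
  then have "Dh (A ** P) - (Dh A - Dh (A ** P)) = Dh A"
    by (simp only: AQ linear_diff[OF linear_Dh])
  then show ?thesis
    by (simp add: Finite_Cartesian_Product.vec_eq_iff)
qed

text \<open>
Composing any right inverse with the projection keeps it a right inverse, because \<open>Dh\<close> does not notice
the projection.
\<close>

lemma right_inverse_Dh:
  obtains B :: "real^'q \<Rightarrow> real^'n^'m" where "bounded_linear B" "\<And>u. Dh (B u) = u" "\<And>u. B u ** P = B u"
proof -
  obtain B where B: "linear B" "Dh \<circ> B = id"
    using linear_surjective_right_inverse[OF linear_Dh surj_Dh] by blast
  have "bounded_linear (\<lambda>u. B u ** P)"
    using bounded_linear_compose[OF bounded_linear_matrix_mult_left linear_conv_bounded_linear[THEN iffD1, OF B(1)]] .
  moreover have "Dh (B u ** P) = u" for u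
    using B(2) by (simp add: Dh_mult_P fun_eq_iff)
  moreover have "(B u ** P) ** P = B u ** P" for u
    by (simp add: P_idem flip: matrix_mul_assoc)
  ultimately show thesis
    using that[of "\<lambda>u. B u ** P"] by blast
qed

text \<open>
The curve is sought in the form \<open>(1 + (t \<eta> + B u) G) (X + t N)\<close> with \<open>N = \<eta> - \<eta> P\<close>, where \<open>B\<close> is a right
inverse of \<open>Dh\<close> with \<open>B = B P\<close> and \<open>u\<close> is to be determined by \<open>h = 0\<close>.  Its derivative at the origin in
the direction \<open>(dt, du)\<close> is \<open>(dt \<eta> + B du) P + dt N = dt \<eta> + B du\<close>, which \<open>Dh\<close> maps to \<open>du\<close>; this is the
normalization under which \<open>u\<close> starts with velocity 0 and the curve with velocity \<open>\<eta>\<close>.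

The left factor is recorded since it controls the rank, and, for \<open>N = 0\<close>, the row space.
\<close>

lemma zero_curve:
  assumes \<eta>: "Dh \<eta> = 0"
  obtains \<epsilon> \<gamma> where "\<epsilon> > 0" "\<gamma> 0 = X" "(\<gamma> has_vector_derivative \<eta>) (at 0)"
    "smooth_on {-\<epsilon><..<\<epsilon>} \<gamma>" "\<And>t. t \<in> {-\<epsilon><..<\<epsilon>} \<Longrightarrow> h (\<gamma> t) = 0"
    "\<And>t. \<exists>L. \<gamma> t = L ** (X + t *\<^sub>R (\<eta> - \<eta> ** P))"
proof -
  obtain B :: "real^'q \<Rightarrow> real^'n^'m" where B: "bounded_linear B" "\<And>u. Dh (B u) = u" "\<And>u. B u ** P = B u"
    using right_inverse_Dh by blast
  have B0: "B 0 = 0"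
    by (rule linear_0[OF bounded_linear.linear[OF B(1)]])
  define L1 :: "real \<times> (real^'q) \<Rightarrow> real^'m^'m" where "L1 z = (fst z *\<^sub>R \<eta> + B (snd z)) ** G" for z
  define L2 :: "real \<times> (real^'q) \<Rightarrow> real^'n^'m" where "L2 z = fst z *\<^sub>R (\<eta> - \<eta> ** P)" for z
  define \<phi> where "\<phi> z = (mat 1 + L1 z) ** (X + L2 z)" for z
  have bl1: "bounded_linear L1"
    unfolding L1_def
    by (intro bounded_linear_compose[OF bounded_linear_matrix_mult_left] bounded_linear_add
        bounded_linear_compose[OF bounded_linear_scaleR_left bounded_linear_fst]
        bounded_linear_compose[OF B(1) bounded_linear_snd])
  have bl2: "bounded_linear L2"
    unfolding L2_def by (rule bounded_linear_compose[OF bounded_linear_scaleR_left bounded_linear_fst])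
  have L0: "L1 (0, 0) = 0" "L2 (0, 0) = 0"
    by (simp_all add: L1_def L2_def B0)
  have C\<phi>: "C_k_on UNIV \<phi> k" for k
    unfolding \<phi>_def
    by (rule C_k_on_bounded_bilinear[OF open_UNIV bounded_bilinear_matrix_mult
        C_k_on_add[OF open_UNIV C_k_on_const C_k_on_bounded_linear[OF open_UNIV bl1]]
        C_k_on_add[OF open_UNIV C_k_on_const C_k_on_bounded_linear[OF open_UNIV bl2]]])
  have \<phi>0: "\<phi> (0, 0) = X"
    by (simp add: \<phi>_def L0)
  have D\<phi>: "(\<phi> has_derivative (\<lambda>z. fst z *\<^sub>R \<eta> + B (snd z))) (at (0, 0))"
  proof -
    have "((\<lambda>z. mat 1 + L1 z) has_derivative L1) (at (0, 0))"
      using has_derivative_add[OF has_derivative_const bounded_linear_imp_has_derivative[OF bl1]] by simp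
    moreover have "((\<lambda>z. X + L2 z) has_derivative L2) (at (0, 0))"
      using has_derivative_add[OF has_derivative_const bounded_linear_imp_has_derivative[OF bl2]] by simp
    ultimately have "(\<phi> has_derivative (\<lambda>z. (mat 1 + L1 (0, 0)) ** L2 z + L1 z ** (X + L2 (0, 0)))) (at (0, 0))"
      unfolding \<phi>_def by (rule bounded_bilinear.FDERIV[OF bounded_bilinear_matrix_mult])
    moreover have "(mat 1 + L1 (0, 0)) ** L2 z + L1 z ** (X + L2 (0, 0)) = fst z *\<^sub>R \<eta> + B (snd z)" for z
    proof -
      have "L1 z ** X = (fst z *\<^sub>R \<eta> + B (snd z)) ** P"
        by (simp add: L1_def P_eq flip: matrix_mul_assoc)
      also have "\<dots> = fst z *\<^sub>R (\<eta> ** P) + B (snd z)"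
        by (simp add: matrix_add_rdistrib matrix_mult_scaleR_left B(3))
      finally show ?thesis
        by (simp add: L0 L2_def scaleR_diff_right)
    qed
    ultimately show ?thesis by (simp only:)
  qed
  define F where "F z = h (\<phi> z)" for z
  have "smooth_on UNIV F"
    unfolding smooth_on_def F_def by (intro allI C_k_on_compose[OF open_UNIV C\<phi> C_k_h])
  moreover have "F (0, 0) = 0"
    by (simp add: F_def \<phi>0 zero)
  moreover have "(F has_derivative snd) (at (0, 0))"
  proof -
    have "(h has_derivative Dh) (at (\<phi> (0, 0)))"
      using h_has_derivative by (simp only: \<phi>0)
    from has_derivative_compose[OF D\<phi> this]
    have "(F has_derivative (\<lambda>z. Dh (fst z *\<^sub>R \<eta> + B (snd z)))) (at (0, 0))"
      unfolding F_def .
    moreover have "(\<lambda>z. Dh (fst z *\<^sub>R \<eta> + B (snd z))) = snd"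
      by (simp add: fun_eq_iff linear_add[OF linear_Dh] linear_cmul[OF linear_Dh] \<eta> B(2))
    ultimately show ?thesis by simp
  qed
  ultimately obtain \<epsilon> u where \<epsilon>: "\<epsilon> > 0" and u0: "u 0 = 0"
    and Fu: "\<And>t. t \<in> {-\<epsilon><..<\<epsilon>} \<Longrightarrow> F (t, u t) = 0"
    and smooth_u: "smooth_on {-\<epsilon><..<\<epsilon>} u" and Du: "(u has_vector_derivative 0) (at 0)"
    by (rule smooth_implicit_curve) (rule that)
  define \<gamma> where "\<gamma> t = \<phi> (t, u t)" for t
  show thesis
  proof (rule that[of \<epsilon> \<gamma>])
    show "\<epsilon> > 0" by (rule \<epsilon>)
    show "\<gamma> 0 = X" by (simp add: \<gamma>_def u0 \<phi>0)
    show "h (\<gamma> t) = 0" if "t \<in> {-\<epsilon><..<\<epsilon>}" for t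
      using Fu[OF that] by (simp add: F_def \<gamma>_def)
    show "\<exists>L. \<gamma> t = L ** (X + t *\<^sub>R (\<eta> - \<eta> ** P))" for t
      unfolding \<gamma>_def \<phi>_def L2_def fst_conv by blast
    have "((\<lambda>t. (t, u t)) has_derivative (\<lambda>v. (v, v *\<^sub>R 0))) (at 0)"
      using Du unfolding has_vector_derivative_def
      by (intro has_derivative_Pair has_derivative_ident)
    moreover have "(\<phi> has_derivative (\<lambda>z. fst z *\<^sub>R \<eta> + B (snd z))) (at (0, u 0))"
      using D\<phi> by (simp only: u0)
    ultimately have "((\<lambda>t. \<phi> (t, u t)) has_derivative (\<lambda>v. v *\<^sub>R \<eta> + B (v *\<^sub>R 0))) (at 0)"
      using has_derivative_compose[of "\<lambda>t. (t, u t)" "\<lambda>v. (v, v *\<^sub>R 0)" 0 UNIV \<phi>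
          "\<lambda>z. fst z *\<^sub>R \<eta> + B (snd z)"] by simp
    then show "(\<gamma> has_vector_derivative \<eta>) (at 0)"
      unfolding \<gamma>_def[abs_def] has_vector_derivative_def by (simp add: B0)
    show "smooth_on {-\<epsilon><..<\<epsilon>} \<gamma>"
      unfolding smooth_on_def \<gamma>_def
    proof (intro allI C_k_on_compose[OF _ _ C\<phi>])
      fix k
      have I: "open {-\<epsilon><..<\<epsilon>}" by simp
      have "bounded_linear (\<lambda>t::real. (t, 0::real^'q))" "bounded_linear (\<lambda>v::real^'q. (0::real, v))"
        by (intro bounded_linear_Pair bounded_linear_ident bounded_linear_zero)+
      moreover have "C_k_on {-\<epsilon><..<\<epsilon>} u k"
        using smooth_u by (simp only: smooth_on_def)
      ultimately have "C_k_on {-\<epsilon><..<\<epsilon>} (\<lambda>t. (t, 0) + (0, u t)) k"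
        by (intro C_k_on_add[OF I C_k_on_bounded_linear[OF I]]
          C_k_on_compose_bounded_linear[OF I, of "\<lambda>v. (0, v)" u])
      then show "C_k_on {-\<epsilon><..<\<epsilon>} (\<lambda>t. (t, u t)) k"
        by simp
    qed simp
  qed
qed

lemma bouligand_cone_zero_setD:
  assumes "\<eta> \<in> bouligand_cone S X" "S \<subseteq> zero_set h"
  shows "Dh \<eta> = 0"
proof -
  obtain Y t where Y: "\<And>k. Y k \<in> S" and t: "\<And>k. t k > 0" "t \<longlonglongrightarrow> 0"
    and lim: "(\<lambda>k. (Y k - X) /\<^sub>R t k) \<longlonglongrightarrow> \<eta>"
    using assms(1) unfolding bouligand_cone_def by blast
  define v where "v k = (Y k - X) /\<^sub>R t k" for k
  have v: "v \<longlonglongrightarrow> \<eta>" using lim unfolding v_def .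
  have Yv: "Y k - X = t k *\<^sub>R v k" for k
    using t(1)[of k] by (simp add: v_def)
  have "(\<lambda>k. Y k - X) \<longlonglongrightarrow> 0"
    unfolding Yv using tendsto_scaleR[OF t(2) v] by simp
  then have small: "\<forall>\<^sub>F k in sequentially. norm (Y k - X) < d" if "d > 0" for d
    using tendstoD[OF \<open>(\<lambda>k. Y k - X) \<longlonglongrightarrow> 0\<close> that] by (simp add: dist_norm)
  have "norm (Dh \<eta>) \<le> e * norm \<eta>" if "e > 0" for e
  proof -
    obtain d where d: "d > 0" "\<And>y. norm (y - X) < d \<Longrightarrow> norm (h y - h X - Dh (y - X)) \<le> e * norm (y - X)"
      using h_has_derivative \<open>e > 0\<close> unfolding has_derivative_at_alt by blast
    have ev: "\<forall>\<^sub>F k in sequentially. norm (Dh (v k)) \<le> e * norm (v k)"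
      using small[OF d(1)]
    proof eventually_elim
      case (elim k)
      have "h (Y k) = 0"
        using Y[of k] assms(2) by (auto simp: zero_set_def)
      then have "norm (Dh (Y k - X)) \<le> e * norm (Y k - X)"
        using d(2)[OF elim] zero by simp
      then have "t k * norm (Dh (v k)) \<le> t k * (e * norm (v k))"
        using t(1)[of k] by (simp add: Yv linear_cmul[OF linear_Dh] mult_ac)
      then show ?case
        using t(1)[of k] by simp
    qed
    show ?thesis
      by (rule tendsto_le[OF _ tendsto_mult[OF tendsto_const tendsto_norm[OF v]]
          tendsto_norm[OF bounded_linear.tendsto[OF bounded_linear_Dh v]] ev]) simp
  qed
  note bound = this
  have "norm (Dh \<eta>) \<le> 0 + e" if "e > 0" for e
  proof -
    define c where "c = e / (norm \<eta> + 1)"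
    have n: "norm \<eta> + 1 > 0"
      by (rule add_nonneg_pos) simp_all
    have "c > 0"
      using that n by (simp add: c_def)
    then have "c * norm \<eta> \<le> c * (norm \<eta> + 1)"
      by (intro mult_left_mono) simp_all
    also have "\<dots> = e"
      using n by (simp add: c_def)
    finally show ?thesis
      using bound[OF \<open>c > 0\<close>] by simp
  qed
  then have "norm (Dh \<eta>) \<le> 0"
    by (rule field_le_epsilon)
  then show ?thesis by simp
qed

text \<open>
The matrices \<open>Y\<^sub>k (P + t\<^sub>k\<inverse> (1 - P))\<close> stretch the part of \<open>Y\<^sub>k\<close> outside the row space of \<open>X\<close>, which is of
order \<open>t\<^sub>k\<close>, to unit size without raising the rank.
\<close>

lemma bouligand_cone_rank_leD:
  assumes "\<eta> \<in> bouligand_cone S X" "S \<subseteq> rank_le r"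
  shows "rank (X + (\<eta> - \<eta> ** P)) \<le> r"
proof -
  obtain Y t where Y: "\<And>k. Y k \<in> S" and t: "\<And>k. t k > 0" "t \<longlonglongrightarrow> 0"
    and lim: "(\<lambda>k. (Y k - X) /\<^sub>R t k) \<longlonglongrightarrow> \<eta>"
    using assms(1) unfolding bouligand_cone_def by blast
  define v where "v k = (Y k - X) /\<^sub>R t k" for k
  have v: "v \<longlonglongrightarrow> \<eta>" using lim unfolding v_def .
  have Yv: "Y k = X + t k *\<^sub>R v k" for k
    using t(1)[of k] by (simp add: v_def)
  define Z where "Z k = Y k ** (P + (1 / t k) *\<^sub>R (mat 1 - P))" for k
  have Z: "Z = (\<lambda>k. Y k ** P + (v k - v k ** P))"
  proof
    fix k
    show "Z k = Y k ** P + (v k - v k ** P)"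
    using t(1)[of k]
    by (simp add: Z_def Yv matrix_add_rdistrib matrix_add_ldistrib matrix_mult_diff_right
        matrix_mult_scaleR_right matrix_mult_scaleR_left XP algebra_simps)
  qed
  have "Y \<longlonglongrightarrow> X + 0 *\<^sub>R \<eta>"
    unfolding Yv by (intro tendsto_intros t v)
  then have "(\<lambda>k. Y k ** P + (v k - v k ** P)) \<longlonglongrightarrow> X ** P + (\<eta> - \<eta> ** P)"
    by (intro tendsto_intros tendsto_matrix_mult v) simp_all
  then have "Z \<longlonglongrightarrow> X + (\<eta> - \<eta> ** P)"
    by (simp only: XP Z)
  moreover have "rank (Z k) \<le> r" for k
  proof -
    have "rank (Y k) \<le> r"
      using Y[of k] assms(2) by (auto simp: rank_le_def)
    then show ?thesis
      unfolding Z_def by (rule order_trans[OF rank_mul_le_left])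
  qed
  ultimately show ?thesis
    by (rule rank_le_limit)
qed

text \<open>
Along the curve the rank is bounded because \<open>X + t N = (X + N) (P + t (1 - P))\<close> for
\<open>N = \<eta> - \<eta> P\<close>.
\<close>

lemma derivableI:
  assumes "Dh \<eta> = 0" "rank (X + (\<eta> - \<eta> ** P)) \<le> r"
  shows "derivable (rank_le r \<inter> zero_set h) X \<eta>"
proof -
  obtain \<epsilon> \<gamma> where \<gamma>: "\<epsilon> > 0" "\<gamma> 0 = X" "(\<gamma> has_vector_derivative \<eta>) (at 0)"
    "smooth_on {-\<epsilon><..<\<epsilon>} \<gamma>" "\<And>t. t \<in> {-\<epsilon><..<\<epsilon>} \<Longrightarrow> h (\<gamma> t) = 0"
    "\<And>t. \<exists>L. \<gamma> t = L ** (X + t *\<^sub>R (\<eta> - \<eta> ** P))"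
    using zero_curve[OF assms(1)] by blast
  have "rank (\<gamma> t) \<le> r" for t
  proof -
    obtain L where L: "\<gamma> t = L ** (X + t *\<^sub>R (\<eta> - \<eta> ** P))"
      using \<gamma>(6) by blast
    have "(X + (\<eta> - \<eta> ** P)) ** (P + t *\<^sub>R (mat 1 - P)) = X + t *\<^sub>R (\<eta> - \<eta> ** P)"
      by (simp add: matrix_add_rdistrib matrix_add_ldistrib matrix_mult_diff_right diff_mult_P
        matrix_mult_scaleR_right XP)
    then have "rank (X + t *\<^sub>R (\<eta> - \<eta> ** P)) \<le> rank (X + (\<eta> - \<eta> ** P))"
      using rank_mul_le_left by metis
    moreover have "rank (\<gamma> t) \<le> rank (X + t *\<^sub>R (\<eta> - \<eta> ** P))"
      unfolding L by (rule rank_mul_le_right)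
    ultimately show ?thesis using assms(2) by simp
  qed
  moreover have "continuous_on {-\<epsilon><..<\<epsilon>} \<gamma>"
    using \<gamma>(4) unfolding smooth_on_def by (metis C_k_on.simps(1))
  ultimately show ?thesis
    unfolding derivable_def rank_le_def zero_set_def using \<gamma>(1-3,5) by blast
qed

lemma bouligand_coneI:
  assumes "derivable S X \<eta>"
  shows "\<eta> \<in> bouligand_cone S X"
proof -
  obtain \<epsilon> \<gamma> where \<gamma>: "\<epsilon> > 0" "\<And>t. t \<in> {-\<epsilon><..<\<epsilon>} \<Longrightarrow> \<gamma> t \<in> S" "\<gamma> 0 = X"
    "(\<gamma> has_vector_derivative \<eta>) (at 0)"
    using assms unfolding derivable_def by blast
  \<comment> \<open>The offset 2 keeps even the first term strictly inside the interval.\<close>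
  define t where "t k = \<epsilon> / real (k + 2)" for k
  have t: "t k > 0" "t k \<in> {-\<epsilon><..<\<epsilon>}" for k
  proof -
    show "t k > 0" using \<gamma>(1) by (simp add: t_def)
    have "\<epsilon> * 1 < \<epsilon> * real (k + 2)"
      using \<gamma>(1) by (intro mult_strict_left_mono) auto
    then have "t k < \<epsilon>"
      by (simp add: t_def divide_less_eq)
    with \<open>t k > 0\<close> show "t k \<in> {-\<epsilon><..<\<epsilon>}" by simp
  qed
  have lim: "t \<longlonglongrightarrow> 0"
    unfolding t_def by (rule LIMSEQ_ignore_initial_segment[OF lim_const_over_n])
  have "((\<lambda>y. (\<gamma> y - X) /\<^sub>R y) \<longlongrightarrow> \<eta>) (at 0)"
  proof -
    have "((\<lambda>y. (1 / norm (y - 0)) *\<^sub>R (\<gamma> y - (\<gamma> 0 + (y - 0) *\<^sub>R \<eta>))) \<longlongrightarrow> 0) (at 0)"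
      using \<gamma>(4) unfolding has_vector_derivative_def has_derivative_within by blast
    then have "((\<lambda>y. (1 / norm y) *\<^sub>R (\<gamma> y - (X + y *\<^sub>R \<eta>))) \<longlongrightarrow> 0) (at 0)"
      by (simp add: \<gamma>(3))
    then have "((\<lambda>y. norm ((1 / norm y) *\<^sub>R (\<gamma> y - (X + y *\<^sub>R \<eta>)))) \<longlongrightarrow> 0) (at 0)"
      by (rule tendsto_norm_zero)
    moreover have "norm ((1 / norm y) *\<^sub>R (\<gamma> y - (X + y *\<^sub>R \<eta>))) = norm ((\<gamma> y - X) /\<^sub>R y - \<eta>)" if "y \<noteq> 0" for y
    proof -
      have "(\<gamma> y - X) /\<^sub>R y - \<eta> = (1 / y) *\<^sub>R (\<gamma> y - (X + y *\<^sub>R \<eta>))"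
        using that by (simp add: algebra_simps divide_inverse)
      then show ?thesis by simp
    qed
    then have "\<forall>\<^sub>F y in at 0. norm ((1 / norm y) *\<^sub>R (\<gamma> y - (X + y *\<^sub>R \<eta>))) = norm ((\<gamma> y - X) /\<^sub>R y - \<eta>)"
      by (auto simp: eventually_at_filter)
    ultimately have "((\<lambda>y. norm ((\<gamma> y - X) /\<^sub>R y - \<eta>)) \<longlongrightarrow> 0) (at 0)"
      by (rule Lim_transform_eventually)
    then show ?thesis
      by (simp add: tendsto_norm_zero_iff Lim_null[symmetric])
  qed
  moreover have "filterlim t (at 0) sequentially"
    unfolding filterlim_at using lim t(1) by (auto intro!: always_eventually less_imp_neq[symmetric])
  ultimately have "(\<lambda>k. (\<gamma> (t k) - X) /\<^sub>R t k) \<longlonglongrightarrow> \<eta>"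
    by (rule filterlim_compose)
  then show ?thesis
    unfolding bouligand_cone_def using t lim \<gamma>(2)
    by (auto intro!: exI[of _ "\<lambda>k. \<gamma> (t k)"] exI[of _ t])
qed

lemma bouligand_cone_iff:
  "\<eta> \<in> bouligand_cone (rank_le r \<inter> zero_set h) X \<longleftrightarrow> Dh \<eta> = 0 \<and> rank (X + (\<eta> - \<eta> ** P)) \<le> r"
  using bouligand_cone_zero_setD bouligand_cone_rank_leD derivableI bouligand_coneI
  by (meson Int_lower1 Int_lower2)

lemma geometrically_derivable:
  "geometrically_derivable_at (rank_le r \<inter> zero_set h) X"
  unfolding geometrically_derivable_at_def using bouligand_cone_iff derivableI by blast

end

section \<open>Passing between the two matrix types\<close>

abbreviation index_of :: "'i::finite \<Rightarrow> nat" where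
  "index_of \<equiv> to_nat_on UNIV"

lemma bij_index_of: "bij_betw (index_of :: 'i::finite \<Rightarrow> nat) UNIV {..<CARD('i)}"
  by (rule to_nat_on_finite) simp

lemma index_of_less [simp]: "index_of (i :: 'i::finite) < CARD('i)"
  using bij_index_of bij_betwE by blast

lemma from_nat_into_index_of [simp]: "from_nat_into UNIV (index_of (i :: 'i::finite)) = i"
  by (simp add: countable_finite)

lemma index_of_from_nat_into [simp]:
  assumes "k < CARD('i::finite)"
  shows "index_of (from_nat_into UNIV k :: 'i) = k"
proof -
  obtain i :: 'i where "k = index_of i"
    using bij_index_of assms unfolding bij_betw_def by (metis imageE lessThan_iff)
  then show ?thesis by simp
qed

lemma sum_index_of: "(\<Sum>i\<in>UNIV. f (index_of (i :: 'i::finite))) = (\<Sum>k<CARD('i). f k)"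
  by (rule sum.reindex_bij_betw[OF bij_index_of])

text \<open>
The inverse of \<^const>\<open>cart_of_mat\<close>.
\<close>

definition mat_of_cart :: "real^'n^'m \<Rightarrow> real mat" where
  "mat_of_cart X = Matrix.mat CARD('m) CARD('n) (\<lambda>(i, j). X $ from_nat_into UNIV i $ from_nat_into UNIV j)"

lemma mat_of_cart_carrier [simp]: "mat_of_cart (X :: real^'n^'m) \<in> carrier_mat CARD('m) CARD('n)"
  by (simp add: mat_of_cart_def)

lemma cart_of_mat_nth: "(cart_of_mat A :: real^'n^'m) $ i $ j = A $$ (index_of i, index_of j)"
  by (simp add: cart_of_mat_def)

lemma cart_of_mat_of_cart [simp]: "cart_of_mat (mat_of_cart X) = X"
  by (simp add: Finite_Cartesian_Product.vec_eq_iff cart_of_mat_nth mat_of_cart_def)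

lemma mat_of_cart_of_mat:
  assumes "A \<in> carrier_mat CARD('m) CARD('n)"
  shows "mat_of_cart (cart_of_mat A :: real^'n^'m) = A"
  using assms by (intro eq_matI) (auto simp: mat_of_cart_def cart_of_mat_nth)

lemma mult_mat_index:
  assumes "A \<in> carrier_mat m k" "B \<in> carrier_mat k n" "i < m" "j < n"
  shows "(A * B) $$ (i, j) = (\<Sum>l<k. A $$ (i, l) * B $$ (l, j))"
  using assms by (auto simp: scalar_prod_def lessThan_atLeast0)

lemma cart_of_mat_mult:
  assumes "A \<in> carrier_mat CARD('m) CARD('k)" "B \<in> carrier_mat CARD('k) CARD('n)"
  shows "(cart_of_mat (A * B) :: real^'n^'m) = (cart_of_mat A :: real^'k^'m) ** cart_of_mat B"
proof (subst Finite_Cartesian_Product.vec_eq_iff, intro allI, subst Finite_Cartesian_Product.vec_eq_iff, intro allI)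
  fix i :: 'm and j :: 'n
  show "(cart_of_mat (A * B) :: real^'n^'m) $ i $ j = ((cart_of_mat A :: real^'k^'m) ** cart_of_mat B) $ i $ j"
    unfolding matrix_matrix_mult_def vec_lambda_beta cart_of_mat_nth
      mult_mat_index[OF assms index_of_less index_of_less]
    by (rule sum_index_of[symmetric])
qed

lemma cart_of_mat_add:
  assumes "A \<in> carrier_mat CARD('m) CARD('n)" "B \<in> carrier_mat CARD('m) CARD('n)"
  shows "(cart_of_mat (A + B) :: real^'n^'m) = cart_of_mat A + cart_of_mat B"
  using assms by (simp add: Finite_Cartesian_Product.vec_eq_iff cart_of_mat_nth)

lemma cart_of_mat_one: "(cart_of_mat (1\<^sub>m CARD('n)) :: real^'n^'n) = Finite_Cartesian_Product.mat 1"
  by (simp add: Finite_Cartesian_Product.vec_eq_iff cart_of_mat_nth Finite_Cartesian_Product.mat_def)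

lemma cart_of_mat_transpose:
  assumes "A \<in> carrier_mat CARD('m) CARD('n)"
  shows "(cart_of_mat (A\<^sup>T) :: real^'m^'n) = transpose (cart_of_mat A :: real^'n^'m)"
  using assms by (simp add: Finite_Cartesian_Product.vec_eq_iff cart_of_mat_nth transpose_def)

section \<open>Rank as inner dimension of a factorization\<close>

text \<open>
Rank at most \<open>k\<close>, phrased in terms of the matrix product alone.  This is what links the ranks of the
two matrix types, and it is visibly preserved by multiplication from either side.
\<close>

definition factors_through :: "real mat \<Rightarrow> nat \<Rightarrow> bool" where
  "factors_through A k \<longleftrightarrow>
    (\<exists>l\<le>k. \<exists>B\<in>carrier_mat (dim_row A) l. \<exists>C\<in>carrier_mat l (dim_col A). A = B * C)"

lemma factors_throughI:
  assumes "l \<le> k" "B \<in> carrier_mat m l" "C \<in> carrier_mat l n"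
  shows "factors_through (B * C) k"
proof -
  have "B \<in> carrier_mat (dim_row (B * C)) l" "C \<in> carrier_mat l (dim_col (B * C))"
    using assms by simp_all
  with assms(1) show ?thesis
    unfolding factors_through_def by blast
qed

lemma factors_throughE:
  assumes "factors_through A k" "A \<in> carrier_mat m n"
  obtains l B C where "l \<le> k" "B \<in> carrier_mat m l" "C \<in> carrier_mat l n" "A = B * C"
  using assms(1) unfolding factors_through_def carrier_matD[OF assms(2)] by blast

lemma factors_through_mult_left:
  assumes "factors_through A k" "A \<in> carrier_mat m n" "L \<in> carrier_mat p m"
  shows "factors_through (L * A) k"
proof -
  obtain l B C where l: "l \<le> k" and B: "B \<in> carrier_mat m l" and C: "C \<in> carrier_mat l n" and A: "A = B * C"
    using assms(1,2) by (rule factors_throughE)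
  have "L * A = (L * B) * C"
    unfolding A by (rule assoc_mult_mat[OF assms(3) B C, symmetric])
  then show ?thesis
    using factors_throughI[OF l mult_carrier_mat[OF assms(3) B] C] by (simp only:)
qed

lemma factors_through_mult_right:
  assumes "factors_through A k" "A \<in> carrier_mat m n" "M \<in> carrier_mat n p"
  shows "factors_through (A * M) k"
proof -
  obtain l B C where l: "l \<le> k" and B: "B \<in> carrier_mat m l" and C: "C \<in> carrier_mat l n" and A: "A = B * C"
    using assms(1,2) by (rule factors_throughE)
  have "A * M = B * (C * M)"
    unfolding A by (rule assoc_mult_mat[OF B C assms(3)])
  then show ?thesis
    using factors_throughI[OF l B mult_carrier_mat[OF C assms(3)]] by (simp only:)
qed

context vec_space
begin

lemma rank_mult_le_left:
  assumes "B \<in> carrier_mat n l" "C \<in> carrier_mat l nc"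
  shows "rank (B * C) \<le> rank B"
proof -
  have BC: "B * C \<in> carrier_mat n nc" using assms by simp
  have colsB: "set (cols B) \<subseteq> carrier_vec n" and colsBC: "set (cols (B * C)) \<subseteq> carrier_vec n"
    using cols_dim[of B] cols_dim[of "B * C"] by (simp_all only: carrier_matD[OF assms(1)] carrier_matD[OF BC])
  have subB: "VectorSpace.subspace class_ring (span (set (cols B))) V"
    and subBC: "VectorSpace.subspace class_ring (span (set (cols (B * C)))) V"
    by (rule span_is_subspace, simp add: colsB colsBC)+
  have "col_space (B * C) \<subseteq> col_space B"
    unfolding col_space_eq[OF assms(1)] col_space_eq[OF BC] using assms by auto
  then have "span (set (cols (B * C))) \<subseteq> span (set (cols B))"
    by (simp add: col_space_def)
  then have sub: "VectorSpace.subspace class_ring (span (set (cols (B * C)))) (vs (span (set (cols B))))"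
    by (rule nested_subspaces[OF subB subBC])
  then show ?thesis
    using vectorspace.subspace_dim[OF subspace_is_vs[OF subB] sub fin_dim_span_cols[OF assms(1)]]
      fin_dim_span_cols[OF BC]
    unfolding rank_def by auto
qed

text \<open>
\<open>B\<close> consists of a maximal independent set of columns of \<open>A\<close>, and \<open>C\<close> holds the coordinates of all
columns with respect to it.
\<close>

lemma rank_factorization:
  assumes A: "A \<in> carrier_mat n nc"
  obtains B C where "B \<in> carrier_mat n (rank A)" "C \<in> carrier_mat (rank A) nc" "A = B * C"
proof -
  have colsA: "set (cols A) \<subseteq> carrier_vec n"
    using cols_dim[of A] by (simp only: carrier_matD[OF A])
  have "lin_indpt {}"
    by (rule finite_lin_indpt2) simp_all
  then have "\<exists>S. finite S \<and> maximal S (\<lambda>T. T \<subseteq> set (cols A) \<and> lin_indpt T) \<and> {} \<subseteq> S"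
    by (intro maximal_exists_superset[of "set (cols A)"]) simp_all
  then obtain S where S: "finite S" "maximal S (\<lambda>T. T \<subseteq> set (cols A) \<and> lin_indpt T)"
    by (elim exE conjE)
  have S_sub: "S \<subseteq> set (cols A)" "lin_indpt S"
    and S_max: "\<And>T. S \<subseteq> T \<Longrightarrow> T \<subseteq> set (cols A) \<Longrightarrow> lin_indpt T \<Longrightarrow> T = S"
    using S(2) by (simp_all add: maximal_def)
  have in_span: "c \<in> span S" if "c \<in> set (cols A)" for c
  proof (rule ccontr)
    assume c: "c \<notin> span S"
    then have "c \<notin> S"
      using span_mem[OF subset_trans[OF S_sub(1) colsA]] by (rule contrapos_nn)
    have "lin_indpt (S \<union> {c})"
      using lin_dep_iff_in_span[of S c, OF subset_trans[OF S_sub(1) colsA] S_sub(2) subsetD[OF colsA that] \<open>c \<notin> S\<close>]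
        c by (simp only: simp_thms)
    then have "S \<union> {c} = S"
      using S_sub(1) that by (intro S_max) (simp_all add: subset_insertI)
    with \<open>c \<notin> S\<close> show False by blast
  qed
  obtain bs where bs: "set bs = S" "distinct bs"
    using finite_distinct_list[OF S(1)] by blast
  have len: "length bs = rank A"
    using rank_card_indpt[OF A S(2)] distinct_card[OF bs(2)] bs(1) by simp
  define B where "B = mat_of_cols n bs"
  have B: "B \<in> carrier_mat n (rank A)"
    by (simp add: B_def len mat_of_cols_def)
  have "cols B = bs"
    unfolding B_def using bs(1) S_sub(1) colsA by (intro cols_mat_of_cols) (simp only: subset_trans)
  then have "span S = col_space B"
    by (simp only: col_space_def bs(1))
  have "\<exists>x\<in>carrier_vec (rank A). B *\<^sub>v x = col A j" if "j < nc" for j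
  proof -
    have "col A j \<in> set (cols A)"
      using that A by (simp add: cols_def)
    then have "col A j \<in> col_space B"
      using in_span \<open>span S = col_space B\<close> by blast
    then show ?thesis
      unfolding col_space_eq[OF B] carrier_matD[OF B] by (simp only: mem_Collect_eq)
  qed
  then have "\<forall>j. \<exists>x. j < nc \<longrightarrow> x \<in> carrier_vec (rank A) \<and> B *\<^sub>v x = col A j"
    by blast
  from choice[OF this] obtain x
    where x: "\<And>j. j < nc \<Longrightarrow> x j \<in> carrier_vec (rank A)" "\<And>j. j < nc \<Longrightarrow> B *\<^sub>v x j = col A j"
    by blast
  define C where "C = mat_of_cols (rank A) (map x [0..<nc])"
  have C: "C \<in> carrier_mat (rank A) nc"
    by (simp add: C_def mat_of_cols_def)
  have colC: "col C j = x j" if "j < nc" for j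
    unfolding C_def using x(1) that by (subst col_mat_of_cols) auto
  have "A = B * C"
  proof (rule eq_matI)
    fix i j assume "i < dim_row (B * C)" "j < dim_col (B * C)"
    then have i: "i < n" and j: "j < nc"
      by (simp_all add: carrier_matD[OF B] carrier_matD[OF C])
    have "(B * C) $$ (i, j) = vec_index (B *\<^sub>v x j) i"
      using i j by (simp add: carrier_matD[OF B] carrier_matD[OF C] colC)
    also have "\<dots> = A $$ (i, j)"
      unfolding x(2)[OF j] using i j by (simp add: carrier_matD[OF A])
    finally show "A $$ (i, j) = (B * C) $$ (i, j)"
      by (rule sym)
  qed (simp_all only: index_mult_mat carrier_matD[OF A] carrier_matD[OF B] carrier_matD[OF C])
  then show thesis by (rule that[OF B C])
qed

end

lemma vec_space_rank_le_iff:
  fixes A :: "real mat"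
  assumes A: "A \<in> carrier_mat m n"
  shows "vec_space.rank m A \<le> k \<longleftrightarrow> factors_through A k"
proof
  assume k: "vec_space.rank m A \<le> k"
  obtain B C where B: "B \<in> carrier_mat m (vec_space.rank m A)" and C: "C \<in> carrier_mat (vec_space.rank m A) n"
    and BC: "A = B * C"
    using vec_space.rank_factorization[OF A] .
  show "factors_through A k"
    using factors_throughI[OF k B C] unfolding BC[symmetric] .
next
  assume "factors_through A k"
  then obtain l B C where l: "l \<le> k" and B: "B \<in> carrier_mat m l" and C: "C \<in> carrier_mat l n"
    and BC: "A = B * C"
    using A by (rule factors_throughE)
  have "vec_space.rank m A \<le> vec_space.rank m B"
    unfolding BC by (rule vec_space.rank_mult_le_left[OF B C])
  also have "\<dots> \<le> l"
    by (rule vec_space.rank_le_nc[OF B])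
  finally show "vec_space.rank m A \<le> k"
    using l by simp
qed

lemma cart_rank_le_iff:
  assumes A: "A \<in> carrier_mat CARD('m) CARD('n)"
  shows "rank (cart_of_mat A :: real^'n^'m) \<le> k \<longleftrightarrow> factors_through A k"
proof
  let ?X = "cart_of_mat A :: real^'n^'m"
  assume "rank ?X \<le> k"
  obtain S where S: "S \<subseteq> range ((*v) ?X)" "independent S" "range ((*v) ?X) \<subseteq> span S"
    "card S = dim (range ((*v) ?X))"
    using basis_exists[of "range ((*v) ?X)"] by blast
  have fin: "finite S"
    using S(2) by (rule independent_imp_finite)
  define l where "l = card S"
  have "l \<le> k"
    using \<open>rank ?X \<le> k\<close> S(4) by (simp add: l_def rank_dim_range)
  obtain b where b: "bij_betw b {..<l} S"
    using ex_bij_betw_nat_finite[OF fin] by (auto simp: l_def lessThan_atLeast0)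
  have "?X *v axis j 1 \<in> span S" for j
    using S(3) by blast
  then have "\<forall>j. \<exists>c. ?X *v axis j 1 = (\<Sum>v\<in>S. c v *\<^sub>R v)"
    unfolding span_finite[OF fin] by blast
  from choice[OF this] obtain c where c: "\<And>j. ?X *v axis j 1 = (\<Sum>v\<in>S. c j v *\<^sub>R v)"
    by blast
  define B where "B = Matrix.mat CARD('m) l (\<lambda>(i, p). b p $ (from_nat_into UNIV i :: 'm))"
  define C where "C = Matrix.mat l CARD('n) (\<lambda>(p, j). c (from_nat_into UNIV j :: 'n) (b p))"
  have B: "B \<in> carrier_mat CARD('m) l" and C: "C \<in> carrier_mat l CARD('n)"
    by (simp_all add: B_def C_def)
  have "A = B * C"
  proof (rule eq_matI)
    fix i j assume "i < dim_row (B * C)" "j < dim_col (B * C)"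
    then have i: "i < CARD('m)" and j: "j < CARD('n)" using B C by auto
    define i' j' where "i' = (from_nat_into UNIV i :: 'm)" and "j' = (from_nat_into UNIV j :: 'n)"
    have "A $$ (i, j) = ?X $ i' $ j'"
      using i j by (simp add: cart_of_mat_nth i'_def j'_def)
    also have "\<dots> = (?X *v axis j' 1) $ i'"
      by (simp add: matrix_vector_mult_basis column_def)
    also have "\<dots> = (\<Sum>v\<in>S. c j' v * v $ i')"
      by (simp add: c)
    also have "\<dots> = (\<Sum>p<l. c j' (b p) * b p $ i')"
      by (rule sum.reindex_bij_betw[OF b, symmetric])
    also have "\<dots> = (B * C) $$ (i, j)"
      unfolding mult_mat_index[OF B C i j] using i j
      by (intro sum.cong) (auto simp: B_def C_def i'_def j'_def)
    finally show "A $$ (i, j) = (B * C) $$ (i, j)" .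
  qed (use A B C in auto)
  then show "factors_through A k"
    using factors_throughI[OF \<open>l \<le> k\<close> B C] by (simp only:)
next
  let ?X = "cart_of_mat A :: real^'n^'m"
  assume "factors_through A k"
  then obtain l B C where l: "l \<le> k" and B: "B \<in> carrier_mat CARD('m) l" and C: "C \<in> carrier_mat l CARD('n)"
    and BC: "A = B * C"
    using A by (rule factors_throughE)
  define b where "b p = (\<chi> i. B $$ (index_of i, p) :: real^'m)" for p
  have "?X *v x = (\<Sum>p<l. (\<Sum>j\<in>UNIV. C $$ (p, index_of j) * x $ j) *\<^sub>R b p)" for x
  proof (subst Finite_Cartesian_Product.vec_eq_iff, intro allI)
    fix i :: 'm
    have "(?X *v x) $ i = (\<Sum>j\<in>UNIV. (\<Sum>p<l. B $$ (index_of i, p) * C $$ (p, index_of j)) * x $ j)"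
      by (simp add: matrix_vector_mult_def cart_of_mat_nth BC mult_mat_index[OF B C])
    also have "\<dots> = (\<Sum>p<l. \<Sum>j\<in>UNIV. B $$ (index_of i, p) * C $$ (p, index_of j) * x $ j)"
      unfolding sum_distrib_right by (rule sum.swap)
    also have "\<dots> = (\<Sum>p<l. (\<Sum>j\<in>UNIV. C $$ (p, index_of j) * x $ j) *\<^sub>R b p) $ i"
      by (simp add: b_def sum_distrib_left sum_distrib_right mult_ac)
    finally show "(?X *v x) $ i = (\<Sum>p<l. (\<Sum>j\<in>UNIV. C $$ (p, index_of j) * x $ j) *\<^sub>R b p) $ i" .
  qed
  then have "?X *v x \<in> span (b ` {..<l})" for x
    by (simp only:) (intro span_sum span_scale span_base imageI)
  then have "range ((*v) ?X) \<subseteq> span (b ` {..<l})"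
    by blast
  then have "rank ?X \<le> card (b ` {..<l})"
    unfolding rank_dim_range by (rule dim_le_card) simp
  also have "\<dots> \<le> l"
    using card_image_le[of "{..<l}" b] by simp
  finally show "rank ?X \<le> k"
    using l by simp
qed

section \<open>Orthogonal completions\<close>

(* The premises of this rule leave dimensions open; the variants below read all of them off the matrices. *)
declare assoc_mult_mat [simp del]

lemma mult_mat_assoc_dim:
  "dim_col A = dim_row B \<Longrightarrow> dim_col B = dim_row C \<Longrightarrow> (A * B) * C = A * (B * (C :: real mat))"
  by (rule assoc_mult_mat[of _ "dim_row A" "dim_col A" _ "dim_col B" _ "dim_col C"]) auto

lemma mult_mat_add_distrib_dim:
  "dim_col A = dim_row B \<Longrightarrow> dim_row C = dim_row B \<Longrightarrow> dim_col C = dim_col B \<Longrightarrow>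
    A * (B + C) = A * B + A * (C :: real mat)"
  by (rule mult_add_distrib_mat[of _ "dim_row A" "dim_col A" _ "dim_col B"]) auto

lemma add_mat_mult_distrib_dim:
  "dim_row A = dim_row B \<Longrightarrow> dim_col A = dim_col B \<Longrightarrow> dim_col A = dim_row C \<Longrightarrow>
    (A + B) * C = A * C + B * (C :: real mat)"
  by (rule add_mult_distrib_mat[of _ "dim_row A" "dim_col A" _ _ "dim_col C"]) auto

lemma mult_mat_left_cancel:
  assumes "A * B = 1\<^sub>m k" "dim_col A = dim_row B" "dim_col B = k" "dim_row Y = k"
  shows "A * (B * Y) = (Y :: real mat)"
proof -
  have "A * (B * Y) = (A * B) * Y"
    by (rule mult_mat_assoc_dim[symmetric]) (simp_all only: assms)
  also have "\<dots> = Y"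
    unfolding assms(1) by (rule left_mult_one_mat'[OF assms(4)])
  finally show ?thesis .
qed

lemma mult_mat_left_annihilate:
  assumes "A * B = 0\<^sub>m k l" "dim_col A = dim_row B" "dim_col B = l" "dim_row Y = l"
  shows "A * (B * Y) = (0\<^sub>m k (dim_col Y) :: real mat)"
proof -
  have "A * (B * Y) = (A * B) * Y"
    by (rule mult_mat_assoc_dim[symmetric]) (simp_all only: assms)
  also have "\<dots> = 0\<^sub>m k (dim_col Y)"
    unfolding assms(1) by (rule left_mult_zero_mat'[OF assms(4)])
  finally show ?thesis .
qed

lemma carrier_mat_iff_dim: "A \<in> carrier_mat a b \<longleftrightarrow> dim_row A = a \<and> dim_col A = b"
  by auto

lemma four_block_eq_one_matD:
  assumes c: "A \<in> carrier_mat s s" "B \<in> carrier_mat s d" "C \<in> carrier_mat d s" "D \<in> carrier_mat d d"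
    and eq: "four_block_mat A B C D = (1\<^sub>m (s + d) :: real mat)"
  shows "A = 1\<^sub>m s" "B = 0\<^sub>m s d" "C = 0\<^sub>m d s" "D = 1\<^sub>m d"
proof -
  have e: "four_block_mat A B C D $$ (i, j) = 1\<^sub>m (s + d) $$ (i, j)" for i j
    by (simp only: eq)
  show "A = 1\<^sub>m s"
  proof (rule eq_matI)
    fix i j assume "i < dim_row (1\<^sub>m s :: real mat)" "j < dim_col (1\<^sub>m s :: real mat)"
    then show "A $$ (i, j) = 1\<^sub>m s $$ (i, j)"
      using e[of i j] c by simp
  qed (use c in simp_all)
  show "B = 0\<^sub>m s d"
  proof (rule eq_matI)
    fix i j assume "i < dim_row (0\<^sub>m s d :: real mat)" "j < dim_col (0\<^sub>m s d :: real mat)"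
    then show "B $$ (i, j) = 0\<^sub>m s d $$ (i, j)"
      using e[of i "s + j"] c by simp
  qed (use c in simp_all)
  show "C = 0\<^sub>m d s"
  proof (rule eq_matI)
    fix i j assume "i < dim_row (0\<^sub>m d s :: real mat)" "j < dim_col (0\<^sub>m d s :: real mat)"
    then show "C $$ (i, j) = 0\<^sub>m d s $$ (i, j)"
      using e[of "s + i" j] c by simp
  qed (use c in simp_all)
  show "D = 1\<^sub>m d"
  proof (rule eq_matI)
    fix i j assume "i < dim_row (1\<^sub>m d :: real mat)" "j < dim_col (1\<^sub>m d :: real mat)"
    then show "D $$ (i, j) = 1\<^sub>m d $$ (i, j)"
      using e[of "s + i" "s + j"] c by simp
  qed (use c in simp_all)
qed

text \<open>
A column block matrix is stored as a four-block matrix with empty lower blocks, which become empty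
right blocks under transposition.
\<close>

lemma hcat_transpose:
  assumes "V \<in> carrier_mat n s" "V' \<in> carrier_mat n d"
  shows "(hcat V V')\<^sup>T = four_block_mat (V\<^sup>T) (0\<^sub>m s 0) (V'\<^sup>T) (0\<^sub>m d 0)"
  using transpose_four_block_mat[OF assms zero_carrier_mat[of 0] zero_carrier_mat[of 0]]
    carrier_matD(2)[OF assms(1)] carrier_matD(2)[OF assms(2)]
  by (simp only: hcat_def zero_transpose_mat)

lemma four_block_mat_empty:
  assumes "A \<in> carrier_mat a b" "B \<in> carrier_mat a 0" "C \<in> carrier_mat 0 b" "D \<in> carrier_mat 0 0"
  shows "four_block_mat A B C D = A"
  using assms by (intro eq_matI) auto

lemma hcat_mult_transpose:
  fixes M V :: "real mat"
  assumes M: "M \<in> carrier_mat m s" "M' \<in> carrier_mat m d" and V: "V \<in> carrier_mat n s" "V' \<in> carrier_mat n d"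
  shows "hcat M M' * (hcat V V')\<^sup>T = M * V\<^sup>T + M' * V'\<^sup>T"
proof -
  have VT: "V\<^sup>T \<in> carrier_mat s n" "V'\<^sup>T \<in> carrier_mat d n"
    using V by simp_all
  have hM: "hcat M M' = four_block_mat M M' (0\<^sub>m 0 s) (0\<^sub>m 0 d)"
    by (simp only: hcat_def carrier_matD[OF M(1)] carrier_matD[OF M(2)])
  show ?thesis
    unfolding hcat_transpose[OF V]
    unfolding hM
      mult_four_block_mat[OF M zero_carrier_mat zero_carrier_mat VT(1) zero_carrier_mat VT(2) zero_carrier_mat]
    by (rule four_block_mat_empty[OF add_carrier_mat[OF mult_carrier_mat[OF M(2) VT(2)]]
        add_carrier_mat[OF mult_carrier_mat[OF M(2) zero_carrier_mat]]
        add_carrier_mat[OF mult_carrier_mat[OF zero_carrier_mat VT(2)]]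
        add_carrier_mat[OF mult_carrier_mat[OF zero_carrier_mat zero_carrier_mat]]])
qed

lemma orth_completionD:
  assumes V: "V \<in> carrier_mat n s" and comp: "orth_completion n s V V'"
  shows "s \<le> n" "V' \<in> carrier_mat n (n - s)" "hcat V V' \<in> carrier_mat n n"
    and "V\<^sup>T * V = 1\<^sub>m s" "V\<^sup>T * V' = 0\<^sub>m s (n - s)" "V'\<^sup>T * V = 0\<^sub>m (n - s) s" "V'\<^sup>T * V' = 1\<^sub>m (n - s)"
    and "hcat V V' * (hcat V V')\<^sup>T = 1\<^sub>m n" "V * V\<^sup>T + V' * V'\<^sup>T = 1\<^sub>m n"
proof -
  let ?d = "n - s"
  show V': "V' \<in> carrier_mat n (n - s)"
    using comp by (simp add: orth_completion_def)
  have W: "hcat V V' \<in> carrier_mat n n" and WW: "(hcat V V')\<^sup>T * hcat V V' = 1\<^sub>m n"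
    using comp by (simp_all add: orth_completion_def stiefel_def)
  show "hcat V V' \<in> carrier_mat n n" by (rule W)
  have "dim_col (hcat V V') = s + (n - s)"
    using V V' by (simp add: hcat_def)
  then show sn: "s \<le> n"
    using W by auto
  have VT: "V\<^sup>T \<in> carrier_mat s n" and VT': "V'\<^sup>T \<in> carrier_mat ?d n"
    using V V' by simp_all
  have hV: "hcat V V' = four_block_mat V V' (0\<^sub>m 0 s) (0\<^sub>m 0 ?d)"
    by (simp only: hcat_def carrier_matD[OF V] carrier_matD[OF V'])
  have zeros: "(0\<^sub>m a 0 :: real mat) * 0\<^sub>m 0 b = 0\<^sub>m a b" for a b
    by simp
  have "(hcat V V')\<^sup>T * hcat V V' = four_block_mat (V\<^sup>T * V) (V\<^sup>T * V') (V'\<^sup>T * V) (V'\<^sup>T * V')"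
    unfolding hcat_transpose[OF V V']
    unfolding hV
      mult_four_block_mat[OF VT zero_carrier_mat VT' zero_carrier_mat V V' zero_carrier_mat zero_carrier_mat] zeros
      right_add_zero_mat[OF mult_carrier_mat[OF VT V]] right_add_zero_mat[OF mult_carrier_mat[OF VT V']]
      right_add_zero_mat[OF mult_carrier_mat[OF VT' V]] right_add_zero_mat[OF mult_carrier_mat[OF VT' V']] ..
  then have eq: "four_block_mat (V\<^sup>T * V) (V\<^sup>T * V') (V'\<^sup>T * V) (V'\<^sup>T * V') = 1\<^sub>m (s + ?d)"
    using WW le_add_diff_inverse[OF sn] by (simp only:)
  show "V\<^sup>T * V = 1\<^sub>m s" "V\<^sup>T * V' = 0\<^sub>m s (n - s)" "V'\<^sup>T * V = 0\<^sub>m (n - s) s" "V'\<^sup>T * V' = 1\<^sub>m (n - s)"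
    by (rule four_block_eq_one_matD[OF mult_carrier_mat[OF VT V] mult_carrier_mat[OF VT V']
        mult_carrier_mat[OF VT' V] mult_carrier_mat[OF VT' V'] eq])+
  show WWT: "hcat V V' * (hcat V V')\<^sup>T = 1\<^sub>m n"
    by (rule mat_mult_left_right_inverse[OF _ W WW]) (use W in simp)
  show "V * V\<^sup>T + V' * V'\<^sup>T = 1\<^sub>m n"
    using WWT unfolding hcat_mult_transpose[OF V V' V V'] .
qed

lemma diagonal_mat_left_inverse:
  assumes D: "D \<in> carrier_mat s s" "diagonal_mat D" and nz: "\<And>i. i < s \<Longrightarrow> D $$ (i, i) \<noteq> (0 :: real)"
  obtains D' where "D' \<in> carrier_mat s s" "D' * D = 1\<^sub>m s" "D * D' = 1\<^sub>m s"
proof -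
  define D' where "D' = Matrix.mat s s (\<lambda>(i, j). if i = j then inverse (D $$ (i, i)) else 0)"
  have D': "D' \<in> carrier_mat s s" by (simp add: D'_def)
  have "D' * D = 1\<^sub>m s"
  proof (rule eq_matI)
    fix i j assume "i < dim_row (1\<^sub>m s :: real mat)" "j < dim_col (1\<^sub>m s :: real mat)"
    then have i: "i < s" and j: "j < s" by simp_all
    have "(D' * D) $$ (i, j) = (\<Sum>l<s. if l = i then inverse (D $$ (i, i)) * D $$ (i, j) else 0)"
      unfolding mult_mat_index[OF D' D(1) i j] using i by (intro sum.cong) (auto simp: D'_def)
    also have "\<dots> = inverse (D $$ (i, i)) * D $$ (i, j)"
      using i by simp
    also have "\<dots> = 1\<^sub>m s $$ (i, j)"
      using D i j nz by (cases "i = j") (auto simp: diagonal_mat_def)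
    finally show "(D' * D) $$ (i, j) = 1\<^sub>m s $$ (i, j)" .
  qed (use D D' in simp_all)
  moreover from this have "D * D' = 1\<^sub>m s"
    by (rule mat_mult_left_right_inverse[OF D' D(1)])
  ultimately show thesis using that D' by blast
qed

lemma transpose_cart_gram:
  assumes W: "W \<in> carrier_mat CARD('k::finite) p"
  shows "transpose (cart_of_mat (W * W\<^sup>T) :: real^'k^'k) = cart_of_mat (W * W\<^sup>T)"
proof -
  have WT: "W\<^sup>T \<in> carrier_mat p CARD('k)"
    using W by simp
  have "(W * W\<^sup>T)\<^sup>T = W * W\<^sup>T"
    using transpose_mult[OF W WT] by (simp only: Matrix.transpose_transpose)
  then show ?thesis
    using cart_of_mat_transpose[OF mult_carrier_mat[OF W WT]] by (simp only:)
qed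

text \<open>
\<open>U'\<close> and \<open>V'\<close> are the orthogonal complements written \<open>U_perp\<close> and \<open>V_perp\<close> in the theorem.
\<close>

locale regular_zero_svd =
  fixes h :: "real^'n^'m \<Rightarrow> real^'q" and X :: "real^'n^'m" and s :: nat and U \<Sigma> V U' V' :: "real mat"
  assumes smooth: "smooth_on UNIV h" and invariant: "orthogonally_invariant h"
    and zero: "h X = 0" and regular: "dim (range (frechet_derivative h (at X))) = CARD('q)"
    and svd: "thin_svd s X U \<Sigma> V"
    and U_compl: "orth_completion CARD('m) s U U'" and V_compl: "orth_completion CARD('n) s V V'"
begin

lemma U_carrier: "U \<in> carrier_mat CARD('m) s" and V_carrier: "V \<in> carrier_mat CARD('n) s"
  and \<Sigma>_carrier: "\<Sigma> \<in> carrier_mat s s" and X_eq: "X = cart_of_mat (U * \<Sigma> * V\<^sup>T)"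
  using svd unfolding thin_svd_def stiefel_def by blast+

lemmas UD = orth_completionD[OF U_carrier U_compl]
lemmas VD = orth_completionD[OF V_carrier V_compl]

lemma dims [simp]:
  "dim_row U = CARD('m)" "dim_col U = s" "dim_row V = CARD('n)" "dim_col V = s" "dim_row \<Sigma> = s" "dim_col \<Sigma> = s"
  "dim_row U' = CARD('m)" "dim_col U' = CARD('m) - s" "dim_row V' = CARD('n)" "dim_col V' = CARD('n) - s"
  by (simp_all only: carrier_matD[OF U_carrier] carrier_matD[OF V_carrier] carrier_matD[OF \<Sigma>_carrier]
      carrier_matD[OF UD(2)] carrier_matD[OF VD(2)])

lemmas orth_simps [simp] = UD(4-7) VD(4-7)

lemma mult_cancel_left [simp]:
  assumes "dim_row Y = s"
  shows "U\<^sup>T * (U * Y) = Y" "V\<^sup>T * (V * Y) = Y"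
  by (rule mult_mat_left_cancel[where k = s]; simp add: assms)+

lemma mult_cancel_left_compl [simp]:
  assumes "dim_row Y = CARD('m) - s"
  shows "U'\<^sup>T * (U' * Y) = Y" "U\<^sup>T * (U' * Y) = 0\<^sub>m s (dim_col Y)"
  by (rule mult_mat_left_cancel[where k = "CARD('m) - s"] mult_mat_left_annihilate[where l = "CARD('m) - s"];
      simp add: assms)+

lemma s_le: "s \<le> CARD('m)" "s \<le> CARD('n)"
  by (rule UD VD)+

definition P :: "real^'n^'n" where
  "P = cart_of_mat (V * V\<^sup>T)"

lemma orth_transpose_V: "orthogonal_matrix (cart_of_mat ((hcat V V')\<^sup>T) :: real^'n^'n)"
proof -
  let ?W = "hcat V V'"
  have WT: "?W\<^sup>T \<in> carrier_mat CARD('n) CARD('n)"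
    using VD(3) by simp
  have "transpose (cart_of_mat (?W\<^sup>T) :: real^'n^'n) = cart_of_mat ?W"
    using cart_of_mat_transpose[OF WT] by (simp only: transpose_transpose Matrix.transpose_transpose)
  then have "transpose (cart_of_mat (?W\<^sup>T) :: real^'n^'n) ** cart_of_mat (?W\<^sup>T) =
      (cart_of_mat (?W * ?W\<^sup>T) :: real^'n^'n)"
    by (simp only: cart_of_mat_mult[OF VD(3) WT])
  then show ?thesis
    by (simp only: orthogonal_matrix VD(8) cart_of_mat_one)
qed

text \<open>
By orthogonal invariance, since \<open>[M 0] [V V']\<^sup>T = M V\<^sup>T\<close>.  This transports questions about the restricted
map to the full space, where \<open>X\<close> itself is the image of \<open>U \<Sigma>\<close>.
\<close>

lemma h_restr_eq:
  assumes M: "M \<in> carrier_mat CARD('m) s"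
  shows "h_restr h s M = h (cart_of_mat (M * V\<^sup>T))"
proof -
  let ?Z = "0\<^sub>m CARD('m) (CARD('n) - s) :: real mat"
  have Z: "?Z * V'\<^sup>T = 0\<^sub>m CARD('m) CARD('n)"
    by (rule left_mult_zero_mat) (simp add: VD(2))
  have MV: "M * V\<^sup>T \<in> carrier_mat CARD('m) CARD('n)"
    by (rule mult_carrier_mat[OF M]) (simp add: V_carrier)
  have eq: "hcat M ?Z * (hcat V V')\<^sup>T = M * V\<^sup>T"
    using hcat_mult_transpose[OF M zero_carrier_mat V_carrier VD(2)]
    unfolding Z right_add_zero_mat[OF MV] .
  have 1: "hcat M ?Z \<in> carrier_mat CARD('m) CARD('n)"
  proof (rule carrier_matI)
    show "dim_row (hcat M ?Z) = CARD('m)" "dim_col (hcat M ?Z) = CARD('n)"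
      unfolding hcat_def index_mat_four_block carrier_matD[OF M] using s_le(2) by simp_all
  qed
  have 2: "(hcat V V')\<^sup>T \<in> carrier_mat CARD('n) CARD('n)"
    using VD(3) by simp
  have "(cart_of_mat (M * V\<^sup>T) :: real^'n^'m) =
      cart_of_mat (hcat M ?Z) ** (cart_of_mat ((hcat V V')\<^sup>T) :: real^'n^'n)"
    using cart_of_mat_mult[OF 1 2] unfolding eq .
  then have "h (cart_of_mat (M * V\<^sup>T)) = h (cart_of_mat (hcat M ?Z) ** (cart_of_mat ((hcat V V')\<^sup>T) :: real^'n^'n))"
    by (rule arg_cong)
  also have "\<dots> = h (cart_of_mat (hcat M ?Z))"
    using invariant orth_transpose_V unfolding orthogonally_invariant_def by blast
  finally show ?thesis
    by (simp only: h_restr_def)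
qed

lemma cart_mult_P:
  assumes "E \<in> carrier_mat CARD('m) CARD('n)"
  shows "(cart_of_mat E :: real^'n^'m) ** P = cart_of_mat (E * (V * V\<^sup>T))"
proof -
  have "V * V\<^sup>T \<in> carrier_mat CARD('n) CARD('n)"
    by (simp add: carrier_mat_iff_dim)
  from cart_of_mat_mult[OF assms this] show ?thesis
    by (simp only: P_def)
qed

text \<open>
The matrix \<open>Y\<close> is the pseudoinverse \<open>V \<Sigma>\<inverse> U\<^sup>T\<close>.
\<close>

lemma left_inverse_exists:
  obtains Y :: "real^'m^'n" where "Y ** X = P" "X ** Y = cart_of_mat (U * U\<^sup>T)"
proof -
  have diag: "diagonal_mat \<Sigma>" and pos: "\<forall>i<s. 0 < \<Sigma> $$ (i, i)"
    using svd unfolding thin_svd_def by blast+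
  have nz: "\<Sigma> $$ (i, i) \<noteq> 0" if "i < s" for i
    using pos[rule_format, OF that] by simp
  obtain D where D: "D \<in> carrier_mat s s" "D * \<Sigma> = 1\<^sub>m s" "\<Sigma> * D = 1\<^sub>m s"
    using diagonal_mat_left_inverse[OF \<Sigma>_carrier diag nz] .
  have dD [simp]: "dim_row D = s" "dim_col D = s"
    by (simp_all only: carrier_matD[OF D(1)])
  have D_cancel: "D * (\<Sigma> * Y) = Y" "\<Sigma> * (D * Y) = Y" if "dim_row Y = s" for Y
    by (rule mult_mat_left_cancel[where k = s]; simp add: that D(2,3))+
  let ?Y = "V * D * U\<^sup>T"
  have YX: "?Y * (U * \<Sigma> * V\<^sup>T) = V * V\<^sup>T" and XY: "(U * \<Sigma> * V\<^sup>T) * ?Y = U * U\<^sup>T"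
    by (simp_all add: mult_mat_assoc_dim D_cancel)
  show thesis
  proof (rule that)
    have "(cart_of_mat ?Y :: real^'m^'n) ** X = cart_of_mat (?Y * (U * \<Sigma> * V\<^sup>T))"
      unfolding X_eq by (rule cart_of_mat_mult[symmetric]) (simp_all add: carrier_mat_iff_dim)
    then show "(cart_of_mat ?Y :: real^'m^'n) ** X = P"
      by (simp only: P_def YX)
    have "X ** (cart_of_mat ?Y :: real^'m^'n) = cart_of_mat ((U * \<Sigma> * V\<^sup>T) * ?Y)"
      unfolding X_eq by (rule cart_of_mat_mult[symmetric]) (simp_all add: carrier_mat_iff_dim)
    then show "X ** (cart_of_mat ?Y :: real^'m^'n) = cart_of_mat (U * U\<^sup>T)"
      by (simp only: XY)
  qed
qed

lemma XP: "X ** P = X"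
proof -
  have "U * \<Sigma> * V\<^sup>T \<in> carrier_mat CARD('m) CARD('n)"
    by (simp add: carrier_mat_iff_dim)
  from cart_mult_P[OF this] have "X ** P = cart_of_mat (U * \<Sigma> * V\<^sup>T * (V * V\<^sup>T))"
    by (simp only: X_eq)
  moreover have "U * \<Sigma> * V\<^sup>T * (V * V\<^sup>T) = U * \<Sigma> * V\<^sup>T"
    by (simp add: mult_mat_assoc_dim)
  ultimately show ?thesis
    by (simp only: X_eq)
qed

lemma P_sym: "transpose P = P"
  unfolding P_def by (rule transpose_cart_gram[OF V_carrier])

definition G :: "real^'m^'n" where
  "G = (SOME Y. Y ** X = P)"

sublocale regular_invariant_zero h X P G
proof
  have "\<exists>Y. Y ** X = P"
    by (rule left_inverse_exists) (rule exI)
  then have "G ** X = P"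
    using someI_ex[of "\<lambda>Y. Y ** X = P"] unfolding G_def by blast
  then show "P = G ** X" ..
qed (rule smooth invariant zero regular P_sym XP)+

end

context regular_zero_svd
begin

lemma cart_gram_U_mult_X: "(cart_of_mat (U * U\<^sup>T) :: real^'m^'m) ** X = X"
proof -
  have "U * U\<^sup>T * (U * \<Sigma> * V\<^sup>T) = U * \<Sigma> * V\<^sup>T"
    by (simp add: mult_mat_assoc_dim)
  moreover have "U * U\<^sup>T \<in> carrier_mat CARD('m) CARD('m)" "U * \<Sigma> * V\<^sup>T \<in> carrier_mat CARD('m) CARD('n)"
    by (simp_all add: carrier_mat_iff_dim)
  note cart_of_mat_mult[OF this]
  ultimately show ?thesis
    by (simp only: X_eq)
qed

lemma mult_annihilate_V [simp]:
  assumes "dim_row Y = s"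
  shows "V'\<^sup>T * (V * Y) = 0\<^sub>m (CARD('n) - s) (dim_col Y)"
  by (rule mult_mat_left_annihilate[where l = s]) (simp_all add: assms)

text \<open>
The column space of \<open>X\<close> is that of \<open>U\<close>, so the summand \<open>U J V'\<^sup>T\<close> is absorbed and the rank is
\<open>s + rank (U' R V'\<^sup>T) = s + rank R\<close>.
\<close>

lemma rank_add_normal_iff:
  assumes J: "J \<in> carrier_mat s (CARD('n) - s)" and R: "R \<in> carrier_mat (CARD('m) - s) (CARD('n) - s)"
    and s: "rank X = s" "s \<le> r"
  shows "rank (X + cart_of_mat (U * J * V'\<^sup>T + U' * R * V'\<^sup>T)) \<le> r \<longleftrightarrow>
    vec_space.rank (CARD('m) - s) R \<le> r - s"
proof -
  note [simp] = carrier_matD[OF J] carrier_matD[OF R]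
  define A where "A = U * J * V'\<^sup>T"
  define B where "B = U' * R * V'\<^sup>T"
  have A: "A \<in> carrier_mat CARD('m) CARD('n)" and B: "B \<in> carrier_mat CARD('m) CARD('n)"
    by (simp_all add: A_def B_def carrier_mat_iff_dim)
  have UU: "U * U\<^sup>T \<in> carrier_mat CARD('m) CARD('m)"
    by (simp add: carrier_mat_iff_dim)
  define N where "N = (cart_of_mat (A + B) :: real^'n^'m)"
  define Q where "Q = (cart_of_mat (U * U\<^sup>T) :: real^'m^'m)"
  obtain Y :: "real^'m^'n" where Y: "X ** Y = Q"
    unfolding Q_def by (rule left_inverse_exists)
  have "(A + B) * (V * V\<^sup>T) = 0\<^sub>m CARD('m) CARD('n)"
    by (simp add: A_def B_def mult_mat_assoc_dim add_mat_mult_distrib_dim)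
  then have "N ** P = cart_of_mat (0\<^sub>m CARD('m) CARD('n))"
    unfolding N_def using cart_mult_P[OF add_carrier_mat[OF B, of A]] by (simp only:)
  then have NP: "N ** P = 0"
    by (simp add: Finite_Cartesian_Product.vec_eq_iff cart_of_mat_nth)
  have "U * U\<^sup>T * (A + B) = A"
    by (simp add: A_def B_def mult_mat_assoc_dim mult_mat_add_distrib_dim carrier_mat_iff_dim)
  then have "Q ** N = cart_of_mat A"
    unfolding Q_def N_def using cart_of_mat_mult[OF UU add_carrier_mat[OF B, of A]] by (simp only:)
  then have "N - Q ** N = cart_of_mat B"
    unfolding N_def cart_of_mat_add[OF A B] by simp
  moreover have "rank (X + N) = rank X + rank (N - Q ** N)"
    by (rule rank_add_orthogonal[OF XP NP Y[symmetric]])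
      (simp_all only: Q_def transpose_cart_gram[OF U_carrier] cart_gram_U_mult_X)
  ultimately have "rank (X + N) \<le> r \<longleftrightarrow> rank (cart_of_mat B :: real^'n^'m) \<le> r - s"
    using s by auto
  also have "\<dots> \<longleftrightarrow> factors_through B (r - s)"
    by (rule cart_rank_le_iff[OF B])
  also have "\<dots> \<longleftrightarrow> factors_through R (r - s)"
  proof
    have V'T: "V'\<^sup>T \<in> carrier_mat (CARD('n) - s) CARD('n)" and U'T: "U'\<^sup>T \<in> carrier_mat (CARD('m) - s) CARD('m)"
      by (simp_all add: carrier_mat_iff_dim)
    have "U'\<^sup>T * B * V' = R"
      by (simp add: B_def mult_mat_assoc_dim)
    then show "factors_through B (r - s) \<Longrightarrow> factors_through R (r - s)"
      using factors_through_mult_right[OF factors_through_mult_left[OF _ B U'T] mult_carrier_mat[OF U'T B] VD(2)]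
      by (simp only:)
    show "factors_through R (r - s) \<Longrightarrow> factors_through B (r - s)"
      unfolding B_def
      by (rule factors_through_mult_right[OF factors_through_mult_left[OF _ R UD(2)] mult_carrier_mat[OF UD(2) R] V'T])
  qed
  also have "\<dots> \<longleftrightarrow> vec_space.rank (CARD('m) - s) R \<le> r - s"
    by (rule vec_space_rank_le_iff[OF R, symmetric])
  finally show ?thesis
    unfolding N_def A_def B_def .
qed

lemma mat_decomposition:
  assumes E: "E \<in> carrier_mat CARD('m) CARD('n)"
  shows "E = E * V * V\<^sup>T + U * (U\<^sup>T * E * V') * V'\<^sup>T + U' * (U'\<^sup>T * E * V') * V'\<^sup>T"
proof -
  note [simp] = carrier_matD[OF E]
  have "E = E * (V * V\<^sup>T + V' * V'\<^sup>T)"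
    unfolding VD(9) by (rule right_mult_one_mat[OF E, symmetric])
  then have 1: "E = E * V * V\<^sup>T + E * V' * V'\<^sup>T"
    by (simp add: mult_mat_add_distrib_dim mult_mat_assoc_dim)
  have "E * V' * V'\<^sup>T = (U * U\<^sup>T + U' * U'\<^sup>T) * (E * V' * V'\<^sup>T)"
    unfolding UD(9) by (rule left_mult_one_mat'[symmetric]) simp
  then have 2: "E * V' * V'\<^sup>T = U * (U\<^sup>T * E * V') * V'\<^sup>T + U' * (U'\<^sup>T * E * V') * V'\<^sup>T"
    by (simp add: add_mat_mult_distrib_dim mult_mat_assoc_dim)
  have c: "E * V * V\<^sup>T \<in> carrier_mat CARD('m) CARD('n)"
    "U * (U\<^sup>T * E * V') * V'\<^sup>T \<in> carrier_mat CARD('m) CARD('n)"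
    "U' * (U'\<^sup>T * E * V') * V'\<^sup>T \<in> carrier_mat CARD('m) CARD('n)"
    by (simp_all add: carrier_mat_iff_dim)
  show ?thesis
    by (subst 1, subst 2) (rule assoc_add_mat[OF c, symmetric])
qed

text \<open>
A curve \<open>\<gamma>\<close> in the restricted zero set gives the curve \<open>\<gamma> V\<^sup>T\<close> in the zero set of \<open>h\<close>, through \<open>X\<close> with
velocity \<open>K V\<^sup>T\<close>.
\<close>

lemma tangent_space_imp_derivative_zero:
  assumes "K \<in> tangent_space (zero_set_restr h s) (U * \<Sigma>)"
  shows "Dh (cart_of_mat (K * V\<^sup>T)) = 0"
proof -
  have dimH: "dim_row (U * \<Sigma>) = CARD('m)" "dim_col (U * \<Sigma>) = s"
    by simp_all
  obtain \<epsilon> \<gamma> where K: "K \<in> carrier_mat CARD('m) s" and \<epsilon>: "\<epsilon> > 0"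
    and \<gamma>: "\<And>t. t \<in> {-\<epsilon><..<\<epsilon>} \<Longrightarrow> \<gamma> t \<in> zero_set_restr h s" and \<gamma>0: "\<gamma> 0 = U * \<Sigma>"
    and D: "\<And>i j. i < CARD('m) \<Longrightarrow> j < s \<Longrightarrow> ((\<lambda>t. \<gamma> t $$ (i, j)) has_real_derivative K $$ (i, j)) (at 0)"
    using assms unfolding tangent_space_def dimH by blast
  have VT: "V\<^sup>T \<in> carrier_mat s CARD('n)"
    by (simp add: carrier_mat_iff_dim)
  have \<gamma>_carrier: "\<gamma> t \<in> carrier_mat CARD('m) s" and \<gamma>_zero: "h (cart_of_mat (\<gamma> t * V\<^sup>T)) = 0" if "t \<in> {-\<epsilon><..<\<epsilon>}" for t
    using \<gamma>[OF that] h_restr_eq[of "\<gamma> t"] unfolding zero_set_restr_def by auto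
  \<comment> \<open>Equals \<open>M V\<^sup>T\<close> for m by s matrices, and is defined by the same formula for the values of \<open>\<gamma>\<close> outside the interval, whose dimensions are unknown.\<close>
  define f where "f M = (\<chi> i j. \<Sum>l<s. M $$ (index_of i, l) * V\<^sup>T $$ (l, index_of j) :: real^'n^'m)" for M
  have f: "f M = cart_of_mat (M * V\<^sup>T)" if "M \<in> carrier_mat CARD('m) s" for M
    unfolding f_def cart_of_mat_def mult_mat_index[OF that VT index_of_less index_of_less] ..
  have Df: "((\<lambda>t. f (\<gamma> t)) has_derivative (\<lambda>v. v *\<^sub>R f K)) (at 0)"
  proof (subst has_derivative_componentwise_within, intro ballI)
    fix b :: "real^'n^'m" assume "b \<in> Basis"
    then obtain i j where b: "b = axis i (axis j 1)"
      by (auto simp: Basis_vec_def)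
    have entry: "inner (f M) b = (\<Sum>l<s. M $$ (index_of i, l) * V\<^sup>T $$ (l, index_of j))" for M
      by (simp add: b inner_axis f_def)
    have "((\<lambda>t. \<Sum>l<s. \<gamma> t $$ (index_of i, l) * V\<^sup>T $$ (l, index_of j)) has_real_derivative
        (\<Sum>l<s. K $$ (index_of i, l) * V\<^sup>T $$ (l, index_of j))) (at 0)"
      by (intro DERIV_sum DERIV_cmult_right D index_of_less) simp
    then show "((\<lambda>t. inner (f (\<gamma> t)) b) has_derivative (\<lambda>v. inner (v *\<^sub>R f K) b)) (at 0)"
      unfolding has_field_derivative_def inner_scaleR_left entry by (simp only: mult.commute[of _ "sum _ _"])
  qed
  have "(h has_derivative Dh) (at (f (\<gamma> 0)))"
    using h_has_derivative by (simp only: f \<gamma>0 X_eq carrier_mat_iff_dim dimH simp_thms)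
  from has_derivative_compose[OF Df this]
  have "((\<lambda>t. h (f (\<gamma> t))) has_derivative (\<lambda>v. Dh (v *\<^sub>R f K))) (at 0)" .
  moreover have "((\<lambda>t. h (f (\<gamma> t))) has_derivative (\<lambda>v. 0)) (at 0)"
  proof (rule has_derivative_transform_within_open[OF has_derivative_const])
    show "open {-\<epsilon><..<\<epsilon>}" "0 \<in> {-\<epsilon><..<\<epsilon>}"
      using \<epsilon> by simp_all
    show "0 = h (f (\<gamma> t))" if "t \<in> {-\<epsilon><..<\<epsilon>}" for t
      unfolding f[OF \<gamma>_carrier[OF that]] by (rule \<gamma>_zero[OF that, symmetric])
  qed
  ultimately have "(\<lambda>v. Dh (v *\<^sub>R f K)) = (\<lambda>v. 0)"
    by (rule has_derivative_unique)
  then have "Dh (1 *\<^sub>R f K) = 0"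
    by (rule fun_cong)
  then show ?thesis
    by (simp only: scaleR_one f[OF K])
qed

text \<open>
For \<open>\<eta> = K V\<^sup>T\<close> we have \<open>\<eta> P = \<eta>\<close>, so the curve of \<open>zero_curve\<close> consists of matrices \<open>L X\<close>, whose row
spaces lie in that of \<open>V\<^sup>T\<close>; multiplying it by \<open>V\<close> brings it into the restricted zero set.
\<close>

lemma derivative_zero_imp_tangent_space:
  assumes K: "K \<in> carrier_mat CARD('m) s" and zero: "Dh (cart_of_mat (K * V\<^sup>T)) = 0"
  shows "K \<in> tangent_space (zero_set_restr h s) (U * \<Sigma>)"
proof -
  note [simp] = carrier_matD[OF K]
  have KV: "K * V\<^sup>T \<in> carrier_mat CARD('m) CARD('n)" and VT: "V\<^sup>T \<in> carrier_mat s CARD('n)"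
    by (simp_all add: carrier_mat_iff_dim)
  define \<eta> where "\<eta> = (cart_of_mat (K * V\<^sup>T) :: real^'n^'m)"
  have "K * V\<^sup>T * (V * V\<^sup>T) = K * V\<^sup>T"
    by (simp add: mult_mat_assoc_dim)
  then have \<eta>P: "\<eta> ** P = \<eta>"
    unfolding \<eta>_def cart_mult_P[OF KV] by (simp only:)
  obtain \<epsilon> \<gamma> where \<epsilon>: "\<epsilon> > 0" and \<gamma>0: "\<gamma> 0 = X" and D\<gamma>: "(\<gamma> has_vector_derivative \<eta>) (at 0)"
    and smooth_\<gamma>: "smooth_on {-\<epsilon><..<\<epsilon>} \<gamma>" and h\<gamma>: "\<And>t. t \<in> {-\<epsilon><..<\<epsilon>} \<Longrightarrow> h (\<gamma> t) = 0"
    and L: "\<And>t. \<exists>L. \<gamma> t = L ** (X + t *\<^sub>R (\<eta> - \<eta> ** P))"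
    using zero_curve[of \<eta>] zero unfolding \<eta>_def by blast
  have \<gamma>P: "\<gamma> t ** P = \<gamma> t" for t
  proof -
    obtain L where "\<gamma> t = L ** X"
      using L[of t] by (auto simp: \<eta>P)
    then show ?thesis
      by (simp add: XP flip: matrix_mul_assoc)
  qed
  define g where "g t = mat_of_cart (\<gamma> t) * V" for t
  have g_carrier: "g t \<in> carrier_mat CARD('m) s" for t
    unfolding g_def by (rule mult_carrier_mat[OF mat_of_cart_carrier V_carrier])
  have "cart_of_mat (g t * V\<^sup>T) = \<gamma> t" for t
    using cart_mult_P[OF mat_of_cart_carrier[of "\<gamma> t"]] \<gamma>P[of t]
    unfolding g_def assoc_mult_mat[OF mat_of_cart_carrier V_carrier VT] by simp
  then have g_zero: "g t \<in> zero_set_restr h s" if "t \<in> {-\<epsilon><..<\<epsilon>}" for t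
    unfolding zero_set_restr_def using g_carrier h_restr_eq[OF g_carrier] h\<gamma>[OF that] by simp
  have g0: "g 0 = U * \<Sigma>"
  proof -
    have "mat_of_cart X = U * \<Sigma> * V\<^sup>T"
      unfolding X_eq by (rule mat_of_cart_of_mat) (simp add: carrier_mat_iff_dim)
    then show ?thesis
      by (simp add: g_def \<gamma>0 mult_mat_assoc_dim)
  qed
  have entries: "smooth_on {-\<epsilon><..<\<epsilon>} (\<lambda>t. g t $$ (i, j)) \<and>
      ((\<lambda>t. g t $$ (i, j)) has_real_derivative K $$ (i, j)) (at 0)"
    if i: "i < CARD('m)" and j: "j < s" for i j
  proof -
    define \<Lambda> where "\<Lambda> M = (\<Sum>k<CARD('n). (M :: real^'n^'m) $ from_nat_into UNIV i $ from_nat_into UNIV k * V $$ (k, j))" for M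
    have \<Lambda>: "bounded_linear \<Lambda>"
      unfolding \<Lambda>_def
      by (intro bounded_linear_sum bounded_linear_mult_const
          bounded_linear_compose[OF bounded_linear_vec_nth bounded_linear_vec_nth])
    have \<Lambda>_eq: "(mat_of_cart M * V) $$ (i, j) = \<Lambda> M" for M
      unfolding mult_mat_index[OF mat_of_cart_carrier V_carrier i j] \<Lambda>_def
      by (intro sum.cong refl) (simp add: mat_of_cart_def i)
    have g_eq: "(\<lambda>t. g t $$ (i, j)) = (\<lambda>t. \<Lambda> (\<gamma> t))"
      unfolding g_def \<Lambda>_eq ..
    have "K * V\<^sup>T * V = K"
      by (simp add: mult_mat_assoc_dim)
    then have "\<Lambda> \<eta> = K $$ (i, j)"
      unfolding \<Lambda>_eq[symmetric] \<eta>_def mat_of_cart_of_mat[OF KV] by (simp only:)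
    then have "((\<lambda>t. g t $$ (i, j)) has_real_derivative K $$ (i, j)) (at 0)"
      using bounded_linear.has_vector_derivative[OF \<Lambda> D\<gamma>]
      unfolding g_eq has_real_derivative_iff_has_vector_derivative by (simp only:)
    moreover have "smooth_on {-\<epsilon><..<\<epsilon>} (\<lambda>t. g t $$ (i, j))"
      using smooth_\<gamma> unfolding smooth_on_def g_eq
      by (auto intro: C_k_on_compose_bounded_linear[OF _ \<Lambda>])
    ultimately show ?thesis by blast
  qed
  have dimH: "dim_row (U * \<Sigma>) = CARD('m)" "dim_col (U * \<Sigma>) = s"
    by simp_all
  show ?thesis
    unfolding tangent_space_def dimH
  proof (intro CollectI conjI exI[of _ \<epsilon>] exI[of _ g])
    show "\<forall>t\<in>{-\<epsilon><..<\<epsilon>}. g t \<in> zero_set_restr h s \<and> g t \<in> carrier_mat CARD('m) s"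
      using g_zero g_carrier by blast
    show "\<forall>i<CARD('m). \<forall>j<s. smooth_on {-\<epsilon><..<\<epsilon>} (\<lambda>t. g t $$ (i, j)) \<and>
        ((\<lambda>t. g t $$ (i, j)) has_real_derivative K $$ (i, j)) (at 0)"
      using entries by blast
  qed (rule K \<epsilon> g0)+
qed

lemma tangent_space_iff:
  "K \<in> tangent_space (zero_set_restr h s) (U * \<Sigma>) \<longleftrightarrow>
    K \<in> carrier_mat CARD('m) s \<and> Dh (cart_of_mat (K * V\<^sup>T)) = 0"
proof -
  have "K \<in> carrier_mat CARD('m) s" if "K \<in> tangent_space (zero_set_restr h s) (U * \<Sigma>)"
    using that unfolding tangent_space_def by simp
  then show ?thesis
    using tangent_space_imp_derivative_zero derivative_zero_imp_tangent_space by blast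
qed

lemma bouligand_cone_eq:
  assumes s: "rank X = s" "s \<le> r"
  shows "bouligand_cone (rank_le r \<inter> zero_set h) X =
    {cart_of_mat (K * V\<^sup>T + U * J * V'\<^sup>T + U' * R * V'\<^sup>T) | K J R.
       K \<in> tangent_space (zero_set_restr h s) (U * \<Sigma>) \<and> J \<in> carrier_mat s (CARD('n) - s) \<and>
       R \<in> carrier_mat (CARD('m) - s) (CARD('n) - s) \<and> vec_space.rank (CARD('m) - s) R \<le> r - s}"
    (is "_ = ?T")
proof -
  have key: "\<eta> \<in> bouligand_cone (rank_le r \<inter> zero_set h) X \<longleftrightarrow>
      K \<in> tangent_space (zero_set_restr h s) (U * \<Sigma>) \<and> vec_space.rank (CARD('m) - s) R \<le> r - s"
    if \<eta>: "\<eta> = cart_of_mat (K * V\<^sup>T + U * J * V'\<^sup>T + U' * R * V'\<^sup>T)"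
      and K: "K \<in> carrier_mat CARD('m) s" and J: "J \<in> carrier_mat s (CARD('n) - s)"
      and R: "R \<in> carrier_mat (CARD('m) - s) (CARD('n) - s)" for \<eta> K J R
  proof -
    note [simp] = carrier_matD[OF K] carrier_matD[OF J] carrier_matD[OF R]
    have KV: "K * V\<^sup>T \<in> carrier_mat CARD('m) CARD('n)"
      and A: "U * J * V'\<^sup>T \<in> carrier_mat CARD('m) CARD('n)"
      and B: "U' * R * V'\<^sup>T \<in> carrier_mat CARD('m) CARD('n)"
      by (simp_all add: carrier_mat_iff_dim)
    define N where "N = (cart_of_mat (U * J * V'\<^sup>T + U' * R * V'\<^sup>T) :: real^'n^'m)"
    have \<eta>N: "\<eta> = cart_of_mat (K * V\<^sup>T) + N"
      unfolding \<eta> N_def assoc_add_mat[OF KV A B] by (rule cart_of_mat_add[OF KV add_carrier_mat[OF B]])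
    have "(K * V\<^sup>T + U * J * V'\<^sup>T + U' * R * V'\<^sup>T) * (V * V\<^sup>T) = K * V\<^sup>T"
      by (simp add: mult_mat_assoc_dim add_mat_mult_distrib_dim carrier_mat_iff_dim)
    then have \<eta>P: "\<eta> ** P = cart_of_mat (K * V\<^sup>T)"
      unfolding \<eta> cart_mult_P[OF add_carrier_mat[OF B]] by (simp only:)
    have "\<eta> - \<eta> ** P = N"
      unfolding \<eta>P by (simp only: \<eta>N add_diff_cancel_left')
    moreover have "Dh \<eta> = Dh (cart_of_mat (K * V\<^sup>T))"
      unfolding \<eta>P[symmetric] by (rule Dh_mult_P[symmetric])
    ultimately show ?thesis
      using rank_add_normal_iff[OF J R s] K
      unfolding bouligand_cone_iff tangent_space_iff N_def by simp
  qed
  show ?thesis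
  proof (intro subset_antisym subsetI)
    fix \<eta> assume \<eta>: "\<eta> \<in> bouligand_cone (rank_le r \<inter> zero_set h) X"
    define E where "E = mat_of_cart \<eta>"
    have E: "E \<in> carrier_mat CARD('m) CARD('n)"
      by (simp only: E_def mat_of_cart_carrier)
    note [simp] = carrier_matD[OF E]
    have K: "E * V \<in> carrier_mat CARD('m) s" and J: "U\<^sup>T * E * V' \<in> carrier_mat s (CARD('n) - s)"
      and R: "U'\<^sup>T * E * V' \<in> carrier_mat (CARD('m) - s) (CARD('n) - s)"
      by (simp_all add: carrier_mat_iff_dim)
    have eq: "\<eta> = cart_of_mat (E * V * V\<^sup>T + U * (U\<^sup>T * E * V') * V'\<^sup>T + U' * (U'\<^sup>T * E * V') * V'\<^sup>T)"
      unfolding mat_decomposition[OF E, symmetric] by (simp only: E_def cart_of_mat_of_cart)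
    show "\<eta> \<in> ?T"
      using eq J R key[OF eq K J R] \<eta> by blast
  next
    fix \<eta> assume "\<eta> \<in> ?T"
    then obtain K J R where \<eta>: "\<eta> = cart_of_mat (K * V\<^sup>T + U * J * V'\<^sup>T + U' * R * V'\<^sup>T)"
      and K: "K \<in> tangent_space (zero_set_restr h s) (U * \<Sigma>)" and J: "J \<in> carrier_mat s (CARD('n) - s)"
      and R: "R \<in> carrier_mat (CARD('m) - s) (CARD('n) - s)" "vec_space.rank (CARD('m) - s) R \<le> r - s"
      by blast
    have "K \<in> carrier_mat CARD('m) s"
      using K unfolding tangent_space_iff by (rule conjunct1)
    from key[OF \<eta> this J R(1)] K R(2) show "\<eta> \<in> bouligand_cone (rank_le r \<inter> zero_set h) X"
      by blast
  qed
qed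

end

section \<open>The Bouligand tangent cone and geometric derivability\<close>

theorem theorem1:
  fixes h :: "real^'n::finite^'m::finite \<Rightarrow> real^'q::finite" and r :: nat
  assumes "r \<le> min CARD('m) CARD('n)"
    and "smooth_on UNIV h"
    and "orthogonally_invariant h"
    and "\<forall>X\<in>zero_set h. dim (range (frechet_derivative h (at X))) = CARD('q)"
  shows "(\<forall>X\<in>rank_le r \<inter> zero_set h. \<forall>s U \<Sigma> V H U_perp V_perp.
            rank X = s \<and> thin_svd s X U \<Sigma> V \<and> H = U * \<Sigma> \<and>
            orth_completion CARD('m) s U U_perp \<and> orth_completion CARD('n) s V V_perp \<longrightarrow>
            bouligand_cone (rank_le r \<inter> zero_set h) X =
              {cart_of_mat (K * V\<^sup>T + U * J * V_perp\<^sup>T + U_perp * R * V_perp\<^sup>T) | K J R.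
                 K \<in> tangent_space (zero_set_restr h s) H \<and>
                 J \<in> carrier_mat s (CARD('n) - s) \<and>
                 R \<in> carrier_mat (CARD('m) - s) (CARD('n) - s) \<and>
                 vec_space.rank (CARD('m) - s) R \<le> r - s})
       \<and> (\<forall>X\<in>rank_le r \<inter> zero_set h. geometrically_derivable_at (rank_le r \<inter> zero_set h) X)"
proof (intro conjI ballI allI impI)
  fix X :: "real^'n^'m" and s U \<Sigma> V H U_perp V_perp
  assume X: "X \<in> rank_le r \<inter> zero_set h"
  assume *: "rank X = s \<and> thin_svd s X U \<Sigma> V \<and> H = U * \<Sigma> \<and>
    orth_completion CARD('m) s U U_perp \<and> orth_completion CARD('n) s V V_perp"
  interpret regular_zero_svd h X s U \<Sigma> V U_perp V_perp
    by unfold_locales (use X * assms in \<open>auto simp: zero_set_def\<close>)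
  have "s \<le> r"
    using X * by (simp add: rank_le_def)
  then show "bouligand_cone (rank_le r \<inter> zero_set h) X =
      {cart_of_mat (K * V\<^sup>T + U * J * V_perp\<^sup>T + U_perp * R * V_perp\<^sup>T) | K J R.
         K \<in> tangent_space (zero_set_restr h s) H \<and>
         J \<in> carrier_mat s (CARD('n) - s) \<and>
         R \<in> carrier_mat (CARD('m) - s) (CARD('n) - s) \<and>
         vec_space.rank (CARD('m) - s) R \<le> r - s}"
    using bouligand_cone_eq[of r] * by blast
next
  fix X :: "real^'n^'m"
  assume X: "X \<in> rank_le r \<inter> zero_set h"
  obtain P G where "transpose P = P" "X ** P = X" "P = G ** X"
    by (rule row_space_projection_exists)
  then interpret regular_invariant_zero h X P G
    by unfold_locales (use X assms in \<open>auto simp: zero_set_def\<close>)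
  show "geometrically_derivable_at (rank_le r \<inter> zero_set h) X"
    by (rule geometrically_derivable)
qed

end
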